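(* Let $d(x)\in\mathbb{Z}[x]$ be a monic, quartic, square-free polynomial for which the continued fraction expansion of $\sqrt{d(x)}$ is periodic of period at least $4$. Then $d(x)$ is Pellian over $\mathbb{Z}[x]$ if and only if there exist a sign $\epsilon\in\{\pm1\}$ and $c\in\mathbb{Z}$ such that, after the change of variables $x\mapsto \epsilon x+c$, \[d(x)=(x^2-2)(x^2+2x-5).\]
   Context: For a commutative ring $R$ with unity, a non-square polynomial $d(x)\in R[x]$ is called Pellian over $R[x]$ if there exist $f(x),g(x)\in R[x]$ with $g(x)\neq 0$ and $f(x)^2-d(x)g(x)^2=1$. Continued fractions are taken in the Laurent series field $\mathbb{Q}((x^{-1}))$: for $h(x)=\sum_{n\le N}h_nx^n$ the principal part is $\lfloor h(x)\rfloor=\sum_{n\ge 0}h_nx^n$; set $\alpha_0=h$ and $\alpha_n=1/(\alpha_{n-1}-\lfloor\alpha_{n-1}\rfloor)$ for $n\ge1$, and $a_n=\lfloor\alpha_n\rfloor$; the continued fraction expansion of $h$ is $[a_0;a_1,a_2,\ldots]$. Here $\sqrt{d(x)}$ denotes the square root in $\mathbb{Q}((x^{-1}))$ with leading term $x^2$. The expansion is periodic of period $n$ if from some point on the sequence of partial quotients repeats with minimal period $n$. *)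

theory Defs
  imports
    "HOL-Computational_Algebra.Computational_Algebra"
begin

unbundle fps_syntax

section \<open>Pellian polynomials\<close>

definition pellian :: "'a::comm_ring_1 poly \<Rightarrow> bool" where
  "pellian d \<longleftrightarrow> \<not> is_square d \<and> (\<exists>f g. g \<noteq> 0 \<and> f\<^sup>2 - d * g\<^sup>2 = 1)"


section \<open>Continued fractions of Laurent series in \<open>1/x\<close>\<close>

text \<open>
  An element \<open>h = \<Sum>n\<le>N. h\<^sub>n x\<^sup>n\<close> of \<open>k((x\<^sup>-\<^sup>1))\<close> is represented by the formal Laurent series
  \<open>H :: k fls\<close> in the variable \<open>X = x\<^sup>-\<^sup>1\<close>, so that \<open>h\<^sub>n = H $$ (-n)\<close> and \<open>x\<close> itself is \<open>fls_X_inv\<close>.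
\<close>

definition poly_to_fls :: "'a::field poly \<Rightarrow> 'a fls" where
  "poly_to_fls p = poly (map_poly fls_const p) fls_X_inv"

text \<open>
  The principal part of the paper includes the constant coefficient, unlike the library's
  \<open>fls_prpart\<close>.
\<close>

definition principal_part :: "'a::field fls \<Rightarrow> 'a poly" where
  "principal_part h = fls_prpart h + [:h $$ 0:]"

lemma coeff_principal_part: "coeff (principal_part h) n = h $$ (- int n)"
  by (cases n) (auto simp: principal_part_def)

lemma nth_poly_to_fls:
  "poly_to_fls p $$ k = (if k \<le> 0 then coeff p (nat (- k)) else 0)"
proof -
  have "poly_to_fls p = (\<Sum>i\<le>degree p. fls_const (coeff p i) * fls_X_inv ^ i)"
    by (simp add: poly_to_fls_def poly_altdef coeff_map_poly degree_map_poly)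
  also have "\<dots> $$ k = (\<Sum>i\<le>degree p. if k = - int i then coeff p i else 0)"
    unfolding fls_nth_sum by (intro sum.cong) (auto simp: fls_X_inv_power_nth)
  also have "\<dots> = (if k \<le> 0 then coeff p (nat (- k)) else 0)"
  proof (cases "k \<le> 0")
    case True
    then have "(\<Sum>i\<le>degree p. if k = - int i then coeff p i else 0)
      = (\<Sum>i\<le>degree p. if i = nat (- k) then coeff p i else 0)"
      by (intro sum.cong) auto
    with True show ?thesis
      by (simp add: coeff_eq_0)
  next
    case False
    then show ?thesis by (intro sum.neutral trans[OF sum.neutral]) auto
  qed
  finally show ?thesis .
qed

primrec cf_complete :: "'a::field fls \<Rightarrow> nat \<Rightarrow> 'a fls" where
  "cf_complete h 0 = h"
| "cf_complete h (Suc n) =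
     inverse (cf_complete h n - poly_to_fls (principal_part (cf_complete h n)))"

definition cf_quotient :: "'a::field fls \<Rightarrow> nat \<Rightarrow> 'a poly" where
  "cf_quotient h n = principal_part (cf_complete h n)"

text \<open>
  As \<open>inverse 0 = 0\<close>, the sequence \<open>cf_complete h\<close> becomes constantly \<open>0\<close> if the expansion of \<open>h\<close>
  terminates; \<open>cf_infinite\<close> excludes this, so that a terminating expansion is never periodic.
\<close>

definition cf_infinite :: "'a::field fls \<Rightarrow> bool" where
  "cf_infinite h \<longleftrightarrow>
     (\<forall>n. cf_complete h n \<noteq> poly_to_fls (principal_part (cf_complete h n)))"

definition eventually_repeats :: "(nat \<Rightarrow> 'b) \<Rightarrow> nat \<Rightarrow> bool" where
  "eventually_repeats a n \<longleftrightarrow> n > 0 \<and> (\<exists>N. \<forall>k\<ge>N. a (k + n) = a k)"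

definition cf_periodic :: "'a::field fls \<Rightarrow> nat \<Rightarrow> bool" where
  "cf_periodic h n \<longleftrightarrow>
     cf_infinite h \<and> eventually_repeats (cf_quotient h) n \<and>
     (\<forall>m<n. \<not> eventually_repeats (cf_quotient h) m)"


section \<open>The square root of a monic quartic polynomial\<close>

text \<open>
  The conditions on \<open>s\<close> other than \<open>s\<^sup>2 = d\<close> say that \<open>s\<close> has leading term \<open>x\<^sup>2\<close>.
\<close>

definition sqrt_quartic :: "int poly \<Rightarrow> rat fls" where
  "sqrt_quartic d =
     (THE s. s\<^sup>2 = poly_to_fls (map_poly of_int d) \<and> fls_subdegree s = -2 \<and> s $$ (-2) = 1)"

lemma sqrt_quartic_ex1:
  fixes d :: "int poly"
  assumes "lead_coeff d = 1" and "degree d = 4"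
  shows "\<exists>!s. s\<^sup>2 = poly_to_fls (map_poly of_int d :: rat poly) \<and> fls_subdegree s = -2 \<and> s $$ (-2) = 1"
proof -
  define D where "D = poly_to_fls (map_poly of_int d :: rat poly)"
  have nth: "D $$ k = (if k \<le> 0 then of_int (coeff d (nat (- k))) else 0)" for k
    by (simp add: D_def nth_poly_to_fls coeff_map_poly)
  define B where "B = fls_regpart (fls_shift (-4) D)"
  have B: "fps_to_fls B = fls_shift (-4) D"
    using assms(2) by (intro fls_eqI) (auto simp: B_def nth coeff_eq_0)
  have B0: "fps_nth B 0 = 1"
    using assms by (simp add: B_def nth)
  define R where "R = fps_radical (\<lambda>_ _. 1) 2 B"
  have R2: "R ^ 2 = B"
    using power_radical[of B "\<lambda>_ _. 1" 1] B0 by (simp add: R_def numeral_2_eq_2)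
  have R0: "fps_nth R 0 = 1"
    by (simp add: R_def numeral_2_eq_2)
  define s where "s = fls_shift 2 (fps_to_fls R)"
  have s2: "s $$ (-2) = 1" by (simp add: s_def R0)
  have sdeg: "fls_subdegree s = -2"
    by (rule fls_subdegree_eqI) (auto simp: s_def R0)
  have "s\<^sup>2 = fls_shift 4 (fps_to_fls (R ^ 2))"
    by (simp add: s_def power2_eq_square fls_times_both_shifted_simp fls_times_fps_to_fls)
  also have "\<dots> = D" by (simp add: R2 B)
  finally have ssq: "s\<^sup>2 = D" .
  show ?thesis
  proof (intro ex1I[of _ s] conjI)
    fix t :: "rat fls"
    assume t: "t\<^sup>2 = poly_to_fls (map_poly of_int d) \<and> fls_subdegree t = -2 \<and> t $$ (-2) = 1"
    then have "t\<^sup>2 = s\<^sup>2" by (simp add: ssq D_def)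
    then have "t = s \<or> t = - s" by (simp add: power2_eq_iff)
    with t s2 show "t = s" by auto
  qed (use ssq s2 sdeg in \<open>auto simp: D_def\<close>)
qed

end

theory Submission
  imports Defs
begin

text \<open>
  Let \<open>u = f + g \<surd>d\<close> be a unit of norm \<open>1\<close> in \<open>\<int>[x, \<surd>d]\<close>.  As \<open>\<surd>d\<close> has coefficients in \<open>\<int>[1/2]\<close>, comparing
  the leading terms of \<open>u\<close> and \<open>1/u\<close> shows that the leading coefficient of \<open>f\<close> is a power of \<open>2\<close>, up to sign.
  So for every odd prime \<open>p\<close> the unit keeps its degree modulo \<open>p\<close>, and no \<open>p\<close>-integral element \<open>F + G \<surd>d\<close> whose
  norm is a nonconstant linear polynomial can have constant norm modulo \<open>p\<close>: this is the injectivity of the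
  reduction of the torsion point \<open>\<infinity>\<^sup>+ - \<infinity>\<^sup>-\<close>, proved here by a congruence modulo a power of \<open>p\<close>.
  Applied to the first four convergents of \<open>\<surd>d\<close>, whose norms are linear polynomials with explicit leading
  coefficients, this says that certain polynomials in the coefficients of \<open>d\<close> are zero or, up to sign, powers
  of \<open>2\<close>.  The first two do not vanish, since otherwise the period is at most \<open>2\<close>.  As also \<open>d\<close> is not of the
  form \<open>A\<^sup>2 + 4 R\<close> with \<open>A\<close> monic and \<open>R\<close> linear, a discussion of parities leaves a single polynomial up to
  \<open>x \<mapsto> \<plusminus>x + c\<close>.
\<close>

section \<open>Units and their leading coefficients\<close>

text \<open>Division by \<open>H\<close> from the top: at index \<open>i + degree H\<close> the
  unknown \<open>coeff P i\<close> meets \<open>lead_coeff H\<close>, and the other terms vanish or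
  contain higher coefficients of \<open>P\<close>. Since only coprimality is used, \<open>Q\<close>
  may be a prime power.\<close>

lemma dvd_coeff_if_dvd_coeff_mult:
  fixes P H :: "int poly"
  assumes cop: "coprime Q (lead_coeff H)"
    and dvd: "\<And>i. i \<ge> j + degree H \<Longrightarrow> Q dvd coeff (P * H) i"
  shows "i \<ge> j \<Longrightarrow> Q dvd coeff P i"
proof (induction "Suc (degree P) - i" arbitrary: i rule: less_induct)
  case less
  show ?case
  proof (cases "i > degree P")
    case True
    then show ?thesis by (simp add: coeff_eq_0)
  next
    case False
    have higher: "Q dvd coeff P k" if "k > i" for k
      using less that False by (intro less.hyps) auto
    have "coeff (P * H) (i + degree H) = (\<Sum>k\<le>i + degree H. coeff P k * coeff H (i + degree H - k))"
      by (simp add: coeff_mult)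
    also have "\<dots> = coeff P i * lead_coeff H
        + (\<Sum>k\<in>{..i + degree H} - {i}. coeff P k * coeff H (i + degree H - k))"
      by (subst sum.remove[of _ i]) auto
    finally have eq: "coeff P i * lead_coeff H = coeff (P * H) (i + degree H)
        - (\<Sum>k\<in>{..i + degree H} - {i}. coeff P k * coeff H (i + degree H - k))"
      by simp
    have "Q dvd (\<Sum>k\<in>{..i + degree H} - {i}. coeff P k * coeff H (i + degree H - k))"
    proof (rule dvd_sum)
      fix k assume "k \<in> {..i + degree H} - {i}"
      then show "Q dvd coeff P k * coeff H (i + degree H - k)"
        using higher[of k] by (cases "k < i") (auto simp: coeff_eq_0)
    qed
    moreover have "Q dvd coeff (P * H) (i + degree H)"
      using less.prems by (intro dvd) auto
    ultimately have "Q dvd coeff P i * lead_coeff H"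
      unfolding eq by (rule dvd_diff[rotated])
    with cop show ?thesis
      by (simp add: coprime_dvd_mult_left_iff)
  qed
qed

lemma degree_lead_coeff_double:
  fixes p q :: "int poly"
  assumes "degree p = n" "degree q = n" "lead_coeff p = c" "lead_coeff q = c" "c \<noteq> 0"
  shows "degree (p + q) = n \<and> lead_coeff (p + q) = 2 * c"
proof -
  have c: "coeff (p + q) n = 2 * c" using assms by simp
  moreover have "degree (p + q) \<le> n" using assms by (simp add: degree_add_le)
  moreover have "degree (p + q) \<ge> n" using c assms(5) by (intro le_degree) auto
  ultimately show ?thesis by simp
qed

locale monic_quartic =
  fixes d :: "int poly"
  assumes lead_coeff_d: "lead_coeff d = 1" and degree_d: "degree d = 4"
begin

lemma d_nonzero: "d \<noteq> 0" using degree_d by auto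

text \<open>As series, \<open>F\<close> and \<open>G * sqrt d\<close> share the leading term
  \<open>l * x ^ k\<close>, so nothing cancels in \<open>F + G * sqrt d\<close>, while in the
  conjugate the leading terms cancel.\<close>

definition balanced :: "nat \<Rightarrow> int \<Rightarrow> int poly \<Rightarrow> int poly \<Rightarrow> bool" where
  "balanced k l F G \<longleftrightarrow>
     l \<noteq> 0 \<and> degree F = k \<and> degree G + 2 = k \<and> lead_coeff F = l \<and> lead_coeff G = l"

text \<open>This multiplies \<open>F + G * sqrt d\<close> by \<open>F' + G' * sqrt d\<close>. Each
  component is a sum of two polynomials with equal leading terms, whence the factor
  \<open>2\<close>.\<close>

lemma balanced_mult:
  assumes "balanced k l F G" "balanced k' l' F' G'"
  shows "balanced (k + k') (2 * l * l') (F * F' + d * G * G') (F * G' + G * F')"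
proof -
  have nz: "F \<noteq> 0" "G \<noteq> 0" "F' \<noteq> 0" "G' \<noteq> 0"
    using assms by (auto simp: balanced_def)
  have l: "lead_coeff F = l" "lead_coeff G = l" "lead_coeff F' = l'" "lead_coeff G' = l'"
    using assms by (auto simp: balanced_def)
  have lead: "lead_coeff (F * F') = l * l'" "lead_coeff (d * G * G') = l * l'"
    "lead_coeff (F * G') = l * l'" "lead_coeff (G * F') = l * l'"
    unfolding lead_coeff_mult using l by (simp_all only: lead_coeff_d mult_1)
  have deg: "degree (F * F') = k + k'" "degree (d * G * G') = k + k'"
    "degree (F * G') = k + k' - 2" "degree (G * F') = k + k' - 2"
  proof -
    have "degree F = k" "degree G + 2 = k" "degree F' = k'" "degree G' + 2 = k'"
      using assms by (auto simp: balanced_def)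
    moreover have "degree (F * F') = degree F + degree F'"
      "degree (d * G * G') = 4 + degree G + degree G'"
      "degree (F * G') = degree F + degree G'" "degree (G * F') = degree G + degree F'"
      using nz d_nonzero by (simp_all add: degree_mult_eq degree_d)
    ultimately show "degree (F * F') = k + k'" "degree (d * G * G') = k + k'"
      "degree (F * G') = k + k' - 2" "degree (G * F') = k + k' - 2"
      by linarith+
  qed
  have "l * l' \<noteq> 0" using assms by (auto simp: balanced_def)
  then have "degree (F * F' + d * G * G') = k + k' \<and> lead_coeff (F * F' + d * G * G') = 2 * (l * l')"
    using lead deg by (intro degree_lead_coeff_double)
  moreover have "degree (F * G' + G * F') = k + k' - 2 \<and> lead_coeff (F * G' + G * F') = 2 * (l * l')"
    using lead deg \<open>l * l' \<noteq> 0\<close> by (intro degree_lead_coeff_double)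
  ultimately show ?thesis using assms by (auto simp: balanced_def)
qed

lemma norm_mult:
  "(F * F' + d * G * G')\<^sup>2 - d * (F * G' + G * F')\<^sup>2 = (F\<^sup>2 - d * G\<^sup>2) * (F'\<^sup>2 - d * G'\<^sup>2)"
  by algebra

text \<open>The leading coefficient acquires only factors \<open>2\<close> and \<open>l\<close>, so
  modulo an odd prime not dividing \<open>l\<close> no power loses degree.\<close>

lemma balanced_power:
  assumes "balanced k l F G"
  shows "\<exists>F' G'. balanced (Suc m * k) (2 ^ m * l ^ Suc m) F' G' \<and>
    F'\<^sup>2 - d * G'\<^sup>2 = (F\<^sup>2 - d * G\<^sup>2) ^ Suc m"
proof (induction m)
  case 0
  then show ?case using assms by (auto simp: algebra_simps)
next
  case (Suc m)
  then obtain F' G' where IH: "balanced (Suc m * k) (2 ^ m * l ^ Suc m) F' G'"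
    "F'\<^sup>2 - d * G'\<^sup>2 = (F\<^sup>2 - d * G\<^sup>2) ^ Suc m"
    by blast
  have "balanced (Suc (Suc m) * k) (2 ^ Suc m * l ^ Suc (Suc m))
     (F * F' + d * G * G') (F * G' + G * F')"
    using balanced_mult[OF assms IH(1)] by (simp add: algebra_simps)
  then show ?case
    using IH(2) by (intro exI[of _ "F * F' + d * G * G'"] exI[of _ "F * G' + G * F'"] conjI)
      (simp_all add: norm_mult)
qed

text \<open>A norm of degree at most \<open>1\<close> cannot affect the leading term of
  \<open>d * G^2\<close>, so the leading coefficients of \<open>F\<close> and \<open>G\<close> agree
  up to sign; \<open>s\<close> chooses between the element and its conjugate.\<close>

lemma balanced_if_norm_small:
  assumes norm: "degree (F\<^sup>2 - d * G\<^sup>2) \<le> 1" and "G \<noteq> 0"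
  shows "\<exists>s\<in>{1,-1}. balanced (degree F) (lead_coeff F) F (smult s G)"
proof -
  define N where "N = F\<^sup>2 - d * G\<^sup>2"
  have dG: "degree (d * G\<^sup>2) = 4 + 2 * degree G"
    using \<open>G \<noteq> 0\<close> d_nonzero by (simp add: degree_mult_eq degree_power_eq degree_d)
  have F: "F\<^sup>2 = d * G\<^sup>2 + N" by (simp add: N_def)
  have degF2: "degree (F\<^sup>2) = 4 + 2 * degree G"
    unfolding F using norm dG by (subst degree_add_eq_left) (auto simp: N_def)
  then have "F \<noteq> 0" by auto
  then have degF: "degree F = degree G + 2" using degF2 by (simp add: degree_power_eq)
  have "lead_coeff (F\<^sup>2) = lead_coeff (N + d * G\<^sup>2)"
    by (simp add: F add.commute)
  also have "\<dots> = lead_coeff (d * G\<^sup>2)"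
    using norm dG by (intro lead_coeff_add_le) (simp add: N_def)
  finally have "lead_coeff (F\<^sup>2) = lead_coeff (d * G\<^sup>2)" .
  then have "(lead_coeff F)\<^sup>2 = (lead_coeff G)\<^sup>2"
    by (simp add: lead_coeff_power lead_coeff_mult lead_coeff_d)
  then have "lead_coeff F = lead_coeff G \<or> lead_coeff F = - lead_coeff G"
    by (simp add: power2_eq_iff)
  moreover have "lead_coeff F \<noteq> 0" using \<open>F \<noteq> 0\<close> by simp
  ultimately show ?thesis using degF by (auto simp: balanced_def simp del: leading_coeff_0_iff)
qed

end

section \<open>Truncations of the Laurent series of sqrt d\<close>

context monic_quartic begin

text \<open>
  \<open>S / (w x\<^sup>M)\<close> is a truncation of the Laurent series \<open>\<surd>d\<close>.
\<close>

definition sqrt_rem :: "nat \<Rightarrow> int \<Rightarrow> int poly \<Rightarrow> int poly" where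
  "sqrt_rem M w S = S\<^sup>2 - [:w:]\<^sup>2 * d * [:0, 1:] ^ (2 * M)"

text \<open>The bound \<open>M + 1\<close> says that \<open>S - w * x ^ M * sqrt d\<close> has
  negative degree, because \<open>S + w * x ^ M * sqrt d\<close> has degree \<open>M + 2\<close>. So
  \<open>S\<close> is the polynomial part of \<open>w * x ^ M * sqrt d\<close>.\<close>

definition sqrt_approx :: "nat \<Rightarrow> int \<Rightarrow> int poly \<Rightarrow> bool" where
  "sqrt_approx M w S \<longleftrightarrow>
     w \<noteq> 0 \<and> degree S = M + 2 \<and> lead_coeff S = w \<and> degree (sqrt_rem M w S) \<le> M + 1"

text \<open>One further coefficient of the series: \<open>c\<close> removes the coefficient of
  \<open>x ^ (M + 3)\<close> from the new remainder, and the factor \<open>u\<close> serves to clear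
  the denominator \<open>2 * w\<close>.\<close>

lemma sqrt_approx_Suc:
  assumes S: "sqrt_approx M w S" and c: "2 * w * c = - (u * coeff (sqrt_rem M w S) (M + 1))"
    and u: "u \<noteq> 0"
  defines "T \<equiv> [:u:] * [:0, 1:] * S + [:c:]"
  shows "sqrt_approx (Suc M) (u * w) T" (is ?A)
    and "sqrt_rem (Suc M) (u * w) T =
      [:u:]\<^sup>2 * [:0, 1:]\<^sup>2 * sqrt_rem M w S + 2 * [:u:] * [:c:] * [:0, 1:] * S + [:c:]\<^sup>2" (is ?B)
proof -
  have uw: "[:u * w:] = [:u:] * [:w:]" by simp
  show B: ?B
  proof -
    have "(U * X * S + C)\<^sup>2 - (U * W)\<^sup>2 * d * (X\<^sup>2 * Y)
      = U\<^sup>2 * X\<^sup>2 * (S\<^sup>2 - W\<^sup>2 * d * Y) + 2 * U * C * X * S + C\<^sup>2" for U X C W Y :: "int poly"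
      by algebra
    then show ?thesis
      unfolding sqrt_rem_def T_def uw mult_Suc_right power_add by blast
  qed
  have coeff_rem: "coeff (sqrt_rem (Suc M) (u * w) T) (Suc (Suc i)) =
      u\<^sup>2 * coeff (sqrt_rem M w S) i + 2 * u * c * coeff S (Suc i)" for i
    unfolding B by (simp add: power2_eq_square numeral_poly algebra_simps)
  have "degree (sqrt_rem (Suc M) (u * w) T) \<le> Suc M + 1"
  proof (rule degree_le, intro allI impI)
    fix i assume i: "i > Suc M + 1"
    define j where "j = i - 2"
    have ij: "i = Suc (Suc j)" "j \<ge> M + 1" using i by (auto simp: j_def)
    show "coeff (sqrt_rem (Suc M) (u * w) T) i = 0"
    proof (cases "j = M + 1")
      case True
      have "coeff S (Suc j) = w" using S True by (auto simp: sqrt_approx_def)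
      then have "coeff (sqrt_rem (Suc M) (u * w) T) i
        = u * (u * coeff (sqrt_rem M w S) (M + 1)) + u * (2 * w * c)"
        using ij True by (simp only: coeff_rem) (simp add: power2_eq_square algebra_simps)
      then show ?thesis unfolding c by simp
    next
      case False
      then show ?thesis using ij S by (simp add: coeff_rem sqrt_approx_def coeff_eq_0)
    qed
  qed
  moreover have "S \<noteq> 0" using S by (auto simp: sqrt_approx_def)
  then have "degree T = Suc M + 2" "lead_coeff T = u * w"
    using S u by (auto simp: T_def sqrt_approx_def degree_add_eq_left)
  ultimately show ?A using S u by (simp add: sqrt_approx_def)
qed

text \<open>The conjugate \<open>f - g * sqrt d\<close> is the inverse of the unit, with leading
  coefficient \<open>1 / (2 * a)\<close>. The integer polynomial \<open>P\<close> approximates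
  \<open>w * x ^ M\<close> times this conjugate, so \<open>w / (2 * a)\<close> is an
  integer.\<close>

lemma sqrt_approx_leading:
  assumes S: "sqrt_approx M w S" and u: "balanced k a f g" "f\<^sup>2 - d * g\<^sup>2 = 1" and M: "M \<ge> 2 * k"
  shows "2 * a dvd w"
proof -
  define x where "x = [:0, 1::int:] ^ M"
  have "lead_coeff x = lead_coeff [:0, 1::int:] ^ M"
    unfolding x_def by (rule lead_coeff_power)
  then have x: "lead_coeff x = 1" "degree x = M" "x \<noteq> 0"
    by (simp_all add: x_def degree_power_eq)
  define P where "P = [:w:] * f * x - g * S"
  define R where "R = [:w:] * f * x + g * S"
  have nz: "w \<noteq> 0" "f \<noteq> 0" "g \<noteq> 0" "S \<noteq> 0" "a \<noteq> 0"
    using S u by (auto simp: sqrt_approx_def balanced_def)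
  have "degree R = k + M \<and> lead_coeff R = 2 * (w * a)"
    unfolding R_def
  proof (rule degree_lead_coeff_double)
    have l: "lead_coeff f = a" "lead_coeff g = a" "lead_coeff S = w" "lead_coeff [:w:] = w"
      using S u by (auto simp: sqrt_approx_def balanced_def)
    show "lead_coeff ([:w:] * f * x) = w * a" "lead_coeff (g * S) = w * a"
      unfolding lead_coeff_mult l x(1) by simp_all
    show "degree ([:w:] * f * x) = k + M" "degree (g * S) = k + M" "w * a \<noteq> 0"
      using nz x S u by (auto simp: degree_mult_eq sqrt_approx_def balanced_def)
  qed
  then have "lead_coeff R = 2 * (w * a)" by blast
  then have leadPR: "lead_coeff (P * R) = lead_coeff P * (2 * (w * a))"
    by (simp only: lead_coeff_mult)
  have PR: "P * R = - (g\<^sup>2 * sqrt_rem M w S) + [:w:]\<^sup>2 * x\<^sup>2"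
  proof -
    have "(W * f * x - g * S) * (W * f * x + g * S) = - (g\<^sup>2 * (S\<^sup>2 - W\<^sup>2 * d * x\<^sup>2)) + W\<^sup>2 * x\<^sup>2"
      if "f\<^sup>2 - d * g\<^sup>2 = 1" for W :: "int poly"
      using that by algebra
    then have "P * R = - (g\<^sup>2 * (S\<^sup>2 - [:w:]\<^sup>2 * d * x\<^sup>2)) + [:w:]\<^sup>2 * x\<^sup>2"
      unfolding P_def R_def using u(2) by blast
    moreover have "x\<^sup>2 = [:0, 1:] ^ (2 * M)"
      by (simp only: x_def power_mult [symmetric] mult.commute)
    ultimately show ?thesis by (simp only: sqrt_rem_def)
  qed
  have "lead_coeff (P * R) = lead_coeff ([:w:]\<^sup>2 * x\<^sup>2)"
    unfolding PR
  proof (rule lead_coeff_add_le)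
    have "degree (g\<^sup>2 * sqrt_rem M w S) \<le> 2 * degree g + (M + 1)"
      using S degree_mult_le[of "g\<^sup>2" "sqrt_rem M w S"] degree_power_le[of g 2]
      by (simp add: sqrt_approx_def)
    \<comment> \<open>Here \<open>M >= 2 * k\<close> is needed: the truncation error must stay below
      the leading term of \<open>[:w:]^2 * x^2\<close>.\<close>
    also have "\<dots> < 2 * M" using M u(1) by (auto simp: balanced_def)
    also have "2 * M = degree ([:w:]\<^sup>2 * x\<^sup>2)"
      using nz x by (simp add: degree_mult_eq degree_power_eq)
    finally show "degree (- (g\<^sup>2 * sqrt_rem M w S)) < degree ([:w:]\<^sup>2 * x\<^sup>2)" by simp
  qed
  also have "\<dots> = w * w"
    unfolding lead_coeff_mult lead_coeff_power x(1) by (simp add: power2_eq_square)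
  finally have "lead_coeff P * (2 * (w * a)) = w * w" using leadPR by (simp only:)
  then have "w * (2 * a * lead_coeff P) = w * w" by (simp only: mult_ac)
  then show ?thesis using nz(1) by (metis mult_left_cancel dvd_triv_left)
qed

lemma d_expand: "d = [:coeff d 0, coeff d 1, coeff d 2, coeff d 3, 1:]"
proof (rule poly_eqI)
  fix n
  have "coeff d 4 = 1" using lead_coeff_d degree_d by simp
  moreover have "coeff d n = 0" if "n > 4" using that degree_d by (simp add: coeff_eq_0)
  ultimately show "coeff d n = coeff [:coeff d 0, coeff d 1, coeff d 2, coeff d 3, 1:] n"
    by (auto simp: coeff_pCons eval_nat_numeral split: nat.splits)
qed

text \<open>Each new coefficient requires a division by \<open>2 * w\<close> only, so the
  denominators remain powers of \<open>2\<close>.\<close>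

lemma sqrt_approx_dyadic: "\<exists>n S. sqrt_approx M (2 ^ n) S"
proof (induction M)
  case 0
  obtain c0 c1 p q where d: "d = [:c0, c1, q, p, 1:]" using d_expand by blast
  \<comment> \<open>\<open>[:r, 4 * p, 8:]\<close> is \<open>8\<close> times the polynomial part
    \<open>x^2 + p * x / 2 + (4 * q - p^2) / 8\<close> of \<open>sqrt d\<close>.\<close>
  define r where "r = 4 * q - p\<^sup>2"
  have "sqrt_rem 0 8 [:r, 4 * p, 8:] = [:r\<^sup>2 - 64 * c0, 8 * p * r - 64 * c1:]"
    using r_def unfolding sqrt_rem_def unfolding d by (simp add: power2_eq_square)
  then have "sqrt_approx 0 (2 ^ 3) [:r, 4 * p, 8:]"
    by (simp add: sqrt_approx_def)
  then show ?case by blast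
next
  case (Suc M)
  then obtain n S where S: "sqrt_approx M (2 ^ n) S" by blast
  define w :: int where "w = 2 ^ n"
  have "sqrt_approx (Suc M) (2 * w * w) ([:2 * w:] * [:0, 1:] * S + [:- coeff (sqrt_rem M w S) (M + 1):])"
  proof (rule sqrt_approx_Suc)
    show "sqrt_approx M w S" using S by (simp add: w_def)
  qed (simp_all add: w_def)
  moreover have "2 * w * w = 2 ^ (2 * n + 1)"
    by (simp only: w_def power_even_eq power_add power_one_right power2_eq_square)
  ultimately have "sqrt_approx (Suc M) (2 ^ (2 * n + 1))
      ([:2 * w:] * [:0, 1:] * S + [:- coeff (sqrt_rem M w S) (M + 1):])"
    by (simp only:)
  then show ?case by blast
qed

text \<open>Like \<open>sqrt (1 + 4 * t)\<close>, the series of \<open>sqrt (A^2 + 4 * r)\<close>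
  has integer coefficients. In the induction, a remainder divisible by \<open>4\<close> makes the
  correction the even integer \<open>2 * e\<close>, which in turn keeps the remainder divisible by
  \<open>4\<close>.\<close>

lemma sqrt_approx_integral:
  assumes d: "d = A\<^sup>2 + 4 * r" and A: "degree A = 2" "lead_coeff A = 1" and r: "degree r \<le> 1"
  shows "\<exists>S. sqrt_approx M 1 S"
proof -
  have "\<exists>S. sqrt_approx M 1 S \<and> 4 dvd sqrt_rem M 1 S"
  proof (induction M)
    case 0
    have "sqrt_rem 0 1 A = - (4 * r)" unfolding sqrt_rem_def by (subst d) (simp add: pCons_one)
    moreover have "degree (4 * r) \<le> 1" using r by (simp add: numeral_poly)
    ultimately show ?case using A by (intro exI[of _ A]) (simp add: sqrt_approx_def)
  next
    case (Suc M)
    then obtain S q where S: "sqrt_approx M 1 S" and q: "sqrt_rem M 1 S = 4 * q"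
      by (auto elim: dvdE)
    define e where "e = - coeff q (M + 1)"
    define T where "T = [:1:] * [:0, 1:] * S + [:2 * e:]"
    have c: "2 * 1 * (2 * e) = - (1 * coeff (sqrt_rem M 1 S) (M + 1))"
      by (simp add: q e_def numeral_poly)
    have "sqrt_approx (Suc M) (1 * 1) T"
      unfolding T_def using S c by (intro sqrt_approx_Suc) auto
    moreover have "sqrt_rem (Suc M) (1 * 1) T =
       [:1:]\<^sup>2 * [:0, 1:]\<^sup>2 * sqrt_rem M 1 S + 2 * [:1:] * [:2 * e:] * [:0, 1:] * S + [:2 * e:]\<^sup>2"
      unfolding T_def using S c by (intro sqrt_approx_Suc) auto
    moreover have "[:2 * e:] = 2 * [:e:]" by (simp add: numeral_poly)
    moreover have "1\<^sup>2 * X\<^sup>2 * (4 * q) + 2 * 1 * (2 * E) * X * S + (2 * E)\<^sup>2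
      = 4 * (X\<^sup>2 * q + E * X * S + E\<^sup>2)" for X E :: "int poly"
      by (simp add: power2_eq_square algebra_simps)
    ultimately have "sqrt_approx (Suc M) 1 T"
      "sqrt_rem (Suc M) 1 T = 4 * ([:0, 1:]\<^sup>2 * q + [:e:] * [:0, 1:] * S + [:e:]\<^sup>2)"
      by (simp_all only: q mult_1_left pCons_one)
    then show ?case by (metis dvd_triv_left)
  qed
  then show ?thesis by blast
qed

end

section \<open>Linear norms modulo odd primes\<close>

text \<open>With \<open>e\<close> the multiplicity, \<open>3 ^ e <= p ^ e <= s\<close>. For
  \<open>p = s = 2\<close> the two sides are equal, which is where the prime \<open>2\<close> drops
  out.\<close>

lemma multiplicity_lt_self:
  fixes p s :: nat
  assumes "prime p" "p > 2" "s \<ge> 2"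
  shows "multiplicity p s + 1 < s"
proof (cases "multiplicity p s = 0")
  case True then show ?thesis using assms by simp
next
  case False
  have "p ^ multiplicity p s dvd s" by (rule multiplicity_dvd)
  then have "p ^ multiplicity p s \<le> s" using assms by (intro dvd_imp_le) auto
  moreover have "3 ^ multiplicity p s \<le> p ^ multiplicity p s"
    using assms by (intro power_mono) auto
  moreover have "n \<ge> 1 \<Longrightarrow> n + 1 < (3::nat) ^ n" for n
    by (induction n rule: nat_induct_at_least) auto
  from this[of "multiplicity p s"] False have "multiplicity p s + 1 < 3 ^ multiplicity p s"
    by simp
  ultimately show ?thesis by linarith
qed

text \<open>In the expansion of \<open>(\<lambda> x + \<mu>)\<^sup>m\<close> the linear coefficient has strictly the smallest \<open>p\<close>-adic valuation
  among the nonconstant ones.  This fails for \<open>p = 2\<close>.\<close>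

lemma dvd_binomial_term:
  fixes lam :: int
  assumes p: "prime p" "p > 2" "int p dvd lam" and s: "2 \<le> s" "s \<le> m" and lam: "lam \<noteq> 0"
  defines "t \<equiv> multiplicity (int p) (int m * lam)"
  shows "int p ^ (t + 1) dvd int (m choose s) * lam ^ s"
proof -
  define e where "e = multiplicity p s"
  obtain c where c: "s = p ^ e * c" "\<not> p dvd c"
    using multiplicity_decompose'[of s p] p s by (auto simp: e_def)
  have "int p ^ t dvd int m * lam" unfolding t_def by (rule multiplicity_dvd)
  moreover have "int p ^ (s - 1) dvd lam ^ (s - 1)" using p by (intro dvd_power_same)
  ultimately have "int p ^ t * int p ^ (s - 1) dvd int m * lam * lam ^ (s - 1)"
    by (rule mult_dvd_mono)
  \<comment> \<open>Absorption replaces the binomial coefficient by an integer times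
    \<open>m / s\<close>; the powers of \<open>p\<close> lost to \<open>s\<close> are fewer than
    those gained from \<open>lam ^ (s - 1)\<close>.\<close>
  moreover have "int s * (int (m choose s) * lam ^ s) = int m * lam * lam ^ (s - 1) * int ((m - 1) choose (s - 1))"
  proof -
    have "s * (m choose s) = m * ((m - 1) choose (s - 1))"
      using s times_binomial_minus1_eq[of s m] by simp
    then have "int s * int (m choose s) = int m * int ((m - 1) choose (s - 1))"
      by (metis of_nat_mult)
    moreover have "lam ^ s = lam * lam ^ (s - 1)" using s by (simp add: power_eq_if)
    ultimately show ?thesis by simp
  qed
  ultimately have "int p ^ (t + (s - 1)) dvd int s * (int (m choose s) * lam ^ s)"
    by (simp add: power_add)
  moreover have "t + (s - 1) = e + (t + (s - 1 - e))" "t + 1 \<le> t + (s - 1 - e)"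
    using multiplicity_lt_self[OF p(1,2) s(1)] by (auto simp: e_def)
  moreover have "int s = int p ^ e * int c"
    using c(1) by (metis of_nat_mult of_nat_power)
  ultimately have "int p ^ e * int p ^ (t + (s - 1 - e)) dvd int p ^ e * (int c * (int (m choose s) * lam ^ s))"
    by (metis power_add mult.assoc)
  then have "int p ^ (t + (s - 1 - e)) dvd int c * (int (m choose s) * lam ^ s)"
    using p by (subst (asm) dvd_mult_cancel_left) auto
  moreover have "coprime (int p ^ (t + (s - 1 - e))) (int c)"
    using c(2) p by (simp add: prime_imp_coprime)
  ultimately have "int p ^ (t + (s - 1 - e)) dvd int (m choose s) * lam ^ s"
    by (simp add: coprime_dvd_mult_right_iff)
  with \<open>t + 1 \<le> _\<close> show ?thesis by (rule power_le_dvd[rotated])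
qed

context monic_quartic begin

text \<open>
  Powers \<open>\<Theta>\<close> of \<open>F + G \<surd>d\<close> and \<open>v\<close> of \<open>u\<close> with the same degree satisfy \<open>v \<Theta>\<^sup>* = E - D \<surd>d\<close>.  Modulo \<open>Q\<close>, chosen
  such that the norm of \<open>\<Theta>\<close> is still linear but not constant, degrees force \<open>D = 0\<close> and \<open>E\<close> constant,
  contradicting \<open>E\<^sup>2 - d D\<^sup>2 = N(\<Theta>)\<close>.
\<close>

lemma norm_linear_coeff:
  fixes p :: nat
  assumes p: "prime p" "p > 2" and u: "balanced k a f g" "f\<^sup>2 - d * g\<^sup>2 = 1" "\<not> int p dvd a"
    and F: "balanced n l F G" "F\<^sup>2 - d * G\<^sup>2 = [:mu, lam:]" "\<not> int p dvd l" and lam: "lam \<noteq> 0"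
  shows "\<not> int p dvd lam"
proof
  assume plam: "int p dvd lam"
  have pp: "prime (int p)" using p by simp
  have nk: "n \<ge> 2" "k \<ge> 2" using u F by (auto simp: balanced_def)
  \<comment> \<open>The unit is raised to the power \<open>n\<close> and the other element to the
    power \<open>k\<close>, so that both have degree \<open>k * n\<close>.\<close>
  obtain f' g' where u': "balanced (k * n) (2 ^ (n - 1) * a ^ n) f' g'" "f'\<^sup>2 - d * g'\<^sup>2 = 1"
    using balanced_power[OF u(1), of "n - 1"] u(2) nk by (auto simp: mult.commute)
  obtain F' G' where F': "balanced (k * n) (2 ^ (k - 1) * l ^ k) F' G'"
    "F'\<^sup>2 - d * G'\<^sup>2 = [:mu, lam:] ^ k"
    using balanced_power[OF F(1), of "k - 1"] F(2) nk by auto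
  define N where "N = [:mu, lam:] ^ k"
  have F'N: "F'\<^sup>2 - d * G'\<^sup>2 = N" using F'(2) by (simp add: N_def)
  \<comment> \<open>\<open>H\<close> is the coefficient of \<open>sqrt d\<close> in the product of
    the two powers, and \<open>D\<close> that in the product with one conjugated, up to sign. By the
    norm equations the leading terms in \<open>D * H\<close> cancel, which bounds \<open>D\<close>
    in terms of \<open>H\<close>.\<close>
  define D where "D = f' * G' - g' * F'"
  define H where "H = f' * G' + g' * F'"
  define E where "E = f' * F' - d * g' * G'"
  have DH: "D * H = G'\<^sup>2 - g'\<^sup>2 * N"
    using u'(2) F'N unfolding D_def H_def by algebra
  have Ef: "E * f' = F' - d * g' * D"
    using u'(2) unfolding E_def D_def by algebra
  have ED: "E\<^sup>2 - d * D\<^sup>2 = N"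
    using u'(2) F'N unfolding E_def D_def by algebra
  have "balanced (k * n + k * n) (2 * (2 ^ (n - 1) * a ^ n) * (2 ^ (k - 1) * l ^ k))
     (f' * F' + d * g' * G') H"
    unfolding H_def by (rule balanced_mult[OF u'(1) F'(1)])
  then have H: "degree H + 2 = 2 * (k * n)"
    "lead_coeff H = 2 * (2 ^ (n - 1) * a ^ n) * (2 ^ (k - 1) * l ^ k)"
    by (auto simp: balanced_def)
  have p2: "\<not> int p dvd 2" using p by (auto dest!: zdvd_imp_le)
  have cop: "coprime (int p ^ j) (lead_coeff H)" "coprime (int p ^ j) (lead_coeff f')" for j
  proof -
    have "coprime (int p) 2" "coprime (int p) a" "coprime (int p) l"
      using prime_imp_coprime[OF pp] p2 u(3) F(3) by blast+
    then show "coprime (int p ^ j) (lead_coeff H)" unfolding H(2) by simp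
    have "lead_coeff f' = 2 ^ (n - 1) * a ^ n" using u'(1) unfolding balanced_def by blast
    then show "coprime (int p ^ j) (lead_coeff f')"
      using \<open>coprime (int p) 2\<close> \<open>coprime (int p) a\<close> by (simp only:) simp
  qed
  have degG': "degree G' + 2 = k * n" "lead_coeff G' = 2 ^ (k - 1) * l ^ k" and degg': "degree g' + 2 = k * n"
    and degf': "degree f' = k * n" and degF': "degree F' = k * n"
    using u' F' by (auto simp: balanced_def)
  have kn: "k * n \<ge> 4" using nk mult_le_mono[of 2 k 2 n] by simp
  have coeffN: "coeff N s = int (k choose s) * lam ^ s * mu ^ (k - s)" for s
  proof (cases "s \<le> k")
    case False
    then have "degree N < s" using degree_power_le[of "[:mu, lam:]" k] lam by (simp add: N_def)
    then show ?thesis using False by (simp add: coeff_eq_0)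
  qed (simp add: N_def coeff_linear_poly_power)
  show False
  proof (cases "int p dvd mu")
    case True
    \<comment> \<open>Here \<open>N\<close> vanishes modulo \<open>p\<close>. Then
      \<open>D * H\<close> has smaller degree than \<open>H\<close> modulo \<open>p\<close>, so
      \<open>D\<close> vanishes and with it \<open>G'^2\<close>, against its leading
      coefficient.\<close>
    have pN: "int p dvd coeff N s" for s
    proof (cases "s = 0")
      case True
      then show ?thesis using dvd_trans[OF \<open>int p dvd mu\<close> dvd_power[of k mu]] nk by (simp add: coeffN)
    next
      case False
      then have "int p dvd lam ^ s" using dvd_trans[OF plam dvd_power[of s lam]] by simp
      then show ?thesis unfolding coeffN by (intro dvd_mult2 dvd_mult)
    qed
    have pgN: "int p dvd coeff (g'\<^sup>2 * N) i" for i
      unfolding coeff_mult using pN by (intro dvd_sum) auto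
    have "int p ^ 1 dvd coeff D i" for i
    proof (rule dvd_coeff_if_dvd_coeff_mult[where j = 0, OF cop(1)])
      fix i assume "0 + degree H \<le> i"
      then have "coeff (G'\<^sup>2) i = 0"
        using H degG' kn degree_power_le[of G' 2] by (intro coeff_eq_0) linarith
      then show "int p ^ 1 dvd coeff (D * H) i"
        unfolding DH using pgN by simp
    qed simp
    then have "int p dvd coeff (D * H) i" for i
      unfolding coeff_mult by (intro dvd_sum) auto
    then have "int p dvd coeff (G'\<^sup>2) i" for i
      using dvd_add[OF _ pgN[of i], of "coeff (D * H) i"] unfolding DH by simp
    then have "int p dvd lead_coeff (G'\<^sup>2)" by blast
    then have "int p dvd 2 ^ (k - 1) * l ^ k"
      unfolding lead_coeff_power degG' by (rule prime_dvd_power[OF pp])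
    then show False
      using prime_dvd_power[OF pp] p2 F(3) unfolding prime_dvd_mult_iff[OF pp] by blast
  next
    case False
    \<comment> \<open>As \<open>p\<close> does not divide \<open>mu\<close>, \<open>t\<close> is the
      exact valuation of the linear coefficient of \<open>N\<close>. So modulo \<open>Q\<close> that
      coefficient survives, whereas all higher ones vanish.\<close>
    define t where "t = multiplicity (int p) (int k * lam)"
    define Q where "Q = int p ^ (t + 1)"
    have QN: "Q dvd coeff N s" if "s \<ge> 2" for s
    proof (cases "s \<le> k")
      case True
      show ?thesis
        unfolding coeffN Q_def t_def
        by (rule dvd_mult2, rule dvd_binomial_term[OF p plam that True lam])
    qed (simp add: coeffN binomial_eq_0 not_le)
    \<comment> \<open>Modulo \<open>Q\<close>, \<open>N\<close> is linear, so
      \<open>G'^2 - g'^2 * N\<close> has degree at most \<open>2 * k * n - 3\<close>, below the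
      degree \<open>2 * k * n - 2\<close> of \<open>H\<close>.\<close>
    have QD: "Q dvd coeff D i" for i
      unfolding Q_def
    proof (rule dvd_coeff_if_dvd_coeff_mult[where j = 0, OF cop(1)])
      fix i assume i: "0 + degree H \<le> i"
      then have "coeff (G'\<^sup>2) i = 0"
        using H degG' kn degree_power_le[of G' 2] by (intro coeff_eq_0) linarith
      moreover have "Q dvd coeff (g'\<^sup>2 * N) i"
        unfolding coeff_mult
      proof (rule dvd_sum)
        fix j assume "j \<in> {..i}"
        show "Q dvd coeff (g'\<^sup>2) j * coeff N (i - j)"
        proof (cases "i - j \<ge> 2")
          case False
          then have "coeff (g'\<^sup>2) j = 0"
            using i H degg' kn degree_power_le[of g' 2] by (intro coeff_eq_0) linarith
          then show ?thesis by simp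
        qed (simp add: QN)
      qed
      ultimately show "int p ^ (t + 1) dvd coeff (D * H) i" unfolding DH Q_def by simp
    qed simp
    have QdD: "Q dvd coeff (R * D) i" for R i
      unfolding coeff_mult using QD by (intro dvd_sum) auto
    \<comment> \<open>Modulo \<open>Q\<close> the product \<open>E * f'\<close> equals
      \<open>F'\<close>, which has the same degree as \<open>f'\<close>; hence \<open>E\<close> is
      constant.\<close>
    have QE: "Q dvd coeff E i" if "i \<ge> 1" for i
      unfolding Q_def
    proof (rule dvd_coeff_if_dvd_coeff_mult[OF cop(2) _ that])
      fix i assume "1 + degree f' \<le> i"
      then have "coeff F' i = 0" using degF' degf' by (intro coeff_eq_0) auto
      then show "int p ^ (t + 1) dvd coeff (E * f') i" unfolding Ef using QdD by (simp add: Q_def)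
    qed
    have "Q dvd coeff (E\<^sup>2) 1"
      using QE[of 1] by (simp add: power2_eq_square coeff_mult)
    moreover have "Q dvd coeff (d * D\<^sup>2) 1"
      using QdD[of "d * D" 1] by (simp add: power2_eq_square mult.assoc)
    ultimately have "Q dvd coeff N 1" unfolding ED[symmetric] by simp
    then have "Q dvd (int k * lam) * mu ^ (k - 1)" using nk by (simp add: coeffN)
    moreover have "coprime Q (mu ^ (k - 1))"
      using False pp by (simp add: Q_def prime_imp_coprime)
    ultimately have "Q dvd int k * lam" by (simp add: coprime_dvd_mult_left_iff)
    moreover have "int k * lam \<noteq> 0" using nk lam by simp
    ultimately show False
      using p(2) power_dvd_iff_le_multiplicity[of "int k * lam" "int p" "t + 1"] by (auto simp: Q_def t_def)
  qed
qed

end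

section \<open>Dyadic rationals\<close>

definition dyadic :: "rat \<Rightarrow> bool" where
  "dyadic q \<longleftrightarrow> (\<exists>n. 2 ^ n * q \<in> \<int>)"

text \<open>The units of \<open>Z[1/2]\<close>: up to sign, the powers of \<open>2\<close> with
  integer exponents.\<close>

definition dyadic_unit :: "rat \<Rightarrow> bool" where
  "dyadic_unit q \<longleftrightarrow> q \<noteq> 0 \<and> dyadic q \<and> dyadic (1 / q)"

lemma dyadic_mono: "2 ^ m * q \<in> \<int> \<Longrightarrow> m \<le> n \<Longrightarrow> 2 ^ n * (q::rat) \<in> \<int>"
proof -
  assume q: "2 ^ m * q \<in> \<int>" and "m \<le> n"
  then have "2 ^ n * q = 2 ^ (n - m) * (2 ^ m * q)"
    by (simp add: power_add [symmetric] mult.assoc [symmetric])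
  also have "\<dots> \<in> \<int>" using q by (rule Ints_mult[OF Ints_power[OF Ints_numeral]])
  finally show ?thesis .
qed

lemma dyadic_of_int [simp]: "dyadic (of_int x)"
  unfolding dyadic_def by (rule exI[of _ 0]) simp

lemma dyadic_0 [simp]: "dyadic 0" and dyadic_1 [simp]: "dyadic 1"
  and dyadic_numeral [simp]: "dyadic (numeral n)"
  using dyadic_of_int[of 0] dyadic_of_int[of 1] dyadic_of_int[of "numeral n"] by simp_all

lemma dyadic_mult [intro]: "dyadic p \<Longrightarrow> dyadic q \<Longrightarrow> dyadic (p * q)"
proof -
  assume "dyadic p" "dyadic q"
  then obtain m n where "2 ^ m * p \<in> \<int>" "2 ^ n * q \<in> \<int>" by (auto simp: dyadic_def)
  then have "(2 ^ m * p) * (2 ^ n * q) \<in> \<int>" by (rule Ints_mult)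
  moreover have "(2 ^ m * p) * (2 ^ n * q) = 2 ^ (m + n) * (p * q)" by (simp add: power_add)
  ultimately show ?thesis unfolding dyadic_def by metis
qed

lemma dyadic_add [intro]: "dyadic p \<Longrightarrow> dyadic q \<Longrightarrow> dyadic (p + q)"
proof -
  assume "dyadic p" "dyadic q"
  then obtain m n where "2 ^ m * p \<in> \<int>" "2 ^ n * q \<in> \<int>" by (auto simp: dyadic_def)
  then have "2 ^ max m n * p \<in> \<int>" "2 ^ max m n * q \<in> \<int>" by (auto intro: dyadic_mono)
  then have "2 ^ max m n * (p + q) \<in> \<int>" by (simp add: distrib_left)
  then show ?thesis unfolding dyadic_def by blast
qed

lemma dyadic_minus [intro]: "dyadic p \<Longrightarrow> dyadic (- p)"
  by (auto simp: dyadic_def)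

lemma dyadic_diff [intro]: "dyadic p \<Longrightarrow> dyadic q \<Longrightarrow> dyadic (p - q)"
  using dyadic_add[of p "- q"] dyadic_minus[of q] by simp

lemma dyadic_power [intro]: "dyadic p \<Longrightarrow> dyadic (p ^ n)"
  by (induction n) auto

lemma dyadic_divide_power2 [intro]: "dyadic p \<Longrightarrow> dyadic (p / 2 ^ n)"
proof -
  have "dyadic (1 / 2 ^ n)" unfolding dyadic_def by (rule exI[of _ n]) simp
  moreover assume "dyadic p"
  ultimately show ?thesis using dyadic_mult[of p "1 / 2 ^ n"] by simp
qed

lemma dyadic_unit_mult: "dyadic_unit p \<Longrightarrow> dyadic_unit q \<Longrightarrow> dyadic_unit (p * q)"
  using dyadic_mult[of "1 / p" "1 / q"] by (auto simp: dyadic_unit_def)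

lemma dyadic_unit_multD: "dyadic_unit (p * q) \<Longrightarrow> dyadic p \<Longrightarrow> dyadic q \<Longrightarrow> dyadic_unit q"
  using dyadic_mult[of p "1 / (p * q)"] by (auto simp: dyadic_unit_def)

lemma dyadic_unit_minus: "dyadic_unit (- p) \<longleftrightarrow> dyadic_unit p"
  using dyadic_minus[of p] dyadic_minus[of "1 / p"] dyadic_minus[of "- p"] dyadic_minus[of "- (1 / p)"]
  by (auto simp: dyadic_unit_def)

lemma dyadic_unit_power2: "dyadic_unit (2 ^ n)"
  by (auto simp: dyadic_unit_def)

lemma dyadic_unit_of_int_iff: "dyadic_unit (of_int x) \<longleftrightarrow> (\<exists>n. x dvd 2 ^ n)"
proof
  assume "dyadic_unit (of_int x)"
  then obtain n k where x: "x \<noteq> 0" "2 ^ n * (1 / of_int x) = (of_int k :: rat)"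
    by (auto simp: dyadic_unit_def dyadic_def elim!: Ints_cases)
  then have "of_int (2 ^ n) = (of_int (k * x) :: rat)" by (simp add: field_simps)
  then have "2 ^ n = k * x" by (simp only: of_int_eq_iff)
  then show "\<exists>n. x dvd 2 ^ n" by (metis dvd_triv_right)
next
  assume "\<exists>n. x dvd 2 ^ n"
  then obtain n k where k: "2 ^ n = x * k" by (auto elim: dvdE)
  then have "x \<noteq> 0" by auto
  have "2 ^ n = (of_int (2 ^ n) :: rat)" by simp
  also have "\<dots> = of_int x * of_int k" by (simp only: k of_int_mult)
  finally have "2 ^ n * (1 / of_int x) = (of_int k :: rat)" using \<open>x \<noteq> 0\<close> by (simp add: field_simps)
  then have "dyadic (1 / of_int x)" unfolding dyadic_def by (metis Ints_of_int)
  with \<open>x \<noteq> 0\<close> show "dyadic_unit (of_int x)" by (simp add: dyadic_unit_def)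
qed

lemma odd_dvd_power2: "odd x \<Longrightarrow> x dvd 2 ^ n \<Longrightarrow> \<bar>x :: int\<bar> = 1"
proof -
  assume "odd x" "x dvd 2 ^ n"
  then have "coprime x (2 ^ n)" by (simp add: coprime_power_right_iff)
  with \<open>x dvd 2 ^ n\<close> have "is_unit x" by (metis coprime_common_divisor dvd_refl)
  then show ?thesis by simp
qed

lemma dvd_power2_if_no_odd_prime:
  fixes x :: int
  assumes "x \<noteq> 0" and no: "\<And>p::nat. prime p \<Longrightarrow> p > 2 \<Longrightarrow> \<not> int p dvd x"
  shows "\<exists>n. x dvd 2 ^ n"
proof -
  define j where "j = multiplicity 2 x"
  obtain c where c: "x = 2 ^ j * c" "\<not> 2 dvd c"
    using multiplicity_decompose'[of x 2] assms(1) by (auto simp: j_def)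
  have "is_unit c"
  proof (rule ccontr)
    assume "\<not> is_unit c"
    moreover have "c \<noteq> 0" using c by auto
    ultimately obtain q where q: "prime q" "q dvd c" using prime_divisor_exists by blast
    then have "prime (nat q)" using prime_int_nat_transfer[of q] by blast
    moreover have "int (nat q) = q" using prime_ge_0_int[OF q(1)] by simp
    moreover have "q \<noteq> 2" using q(2) c(2) by blast
    then have "nat q > 2" using prime_ge_2_int[OF q(1)] by simp
    ultimately show False using no[of "nat q"] q c(1) by (metis dvd_mult)
  qed
  then have "2 ^ j * c dvd 2 ^ j" by (rule mult_unit_dvd_iff [THEN iffD2]) simp
  then have "x dvd 2 ^ j" by (simp only: c(1))
  then show ?thesis by blast
qed

definition dyadic_poly :: "rat poly \<Rightarrow> bool" where
  "dyadic_poly P \<longleftrightarrow> (\<forall>i. dyadic (coeff P i))"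

lemma dyadic_sum: "(\<And>i. i \<in> A \<Longrightarrow> dyadic (h i)) \<Longrightarrow> dyadic (sum h A)"
  by (induction A rule: infinite_finite_induct) auto

lemma dyadic_poly_mult: "dyadic_poly P \<Longrightarrow> dyadic_poly Q \<Longrightarrow> dyadic_poly (P * Q)"
  unfolding dyadic_poly_def coeff_mult by (intro allI dyadic_sum dyadic_mult) auto

lemma dyadic_poly_add: "dyadic_poly P \<Longrightarrow> dyadic_poly Q \<Longrightarrow> dyadic_poly (P + Q)"
  by (auto simp: dyadic_poly_def)

lemma dyadic_poly_diff: "dyadic_poly P \<Longrightarrow> dyadic_poly Q \<Longrightarrow> dyadic_poly (P - Q)"
  by (auto simp: dyadic_poly_def)

lemma dyadic_poly_pCons: "dyadic a \<Longrightarrow> dyadic_poly P \<Longrightarrow> dyadic_poly (pCons a P)"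
  by (auto simp: dyadic_poly_def coeff_pCons split: nat.splits)

lemma dyadic_poly_0: "dyadic_poly 0"
  by (simp add: dyadic_poly_def)

lemmas dyadic_poly_intros =
  dyadic_poly_mult dyadic_poly_add dyadic_poly_diff dyadic_poly_pCons dyadic_poly_0

text \<open>Stated for all large \<open>m\<close>, so that two polynomials can be cleared by the
  same power of \<open>2\<close>.\<close>

lemma dyadic_poly_integral:
  assumes "dyadic_poly P"
  shows "\<exists>n. \<forall>m\<ge>n. \<exists>Q. smult (2 ^ m) P = map_poly of_int Q"
proof -
  have "\<exists>n. \<forall>i. 2 ^ n i * coeff P i \<in> \<int>"
    using assms unfolding dyadic_poly_def dyadic_def by (intro choice)
  then obtain n where n: "\<And>i. 2 ^ n i * coeff P i \<in> \<int>" by blast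
  define N where "N = Max (n ` {..degree P})"
  have "\<exists>Q. smult (2 ^ m) P = map_poly of_int Q" if "m \<ge> N" for m
  proof -
    have "2 ^ m * coeff P i \<in> \<int>" for i
    proof (cases "i \<le> degree P")
      case True
      then have "n i \<le> N" unfolding N_def by (intro Max_ge) auto
      then show ?thesis using n that by (intro dyadic_mono[OF n]) auto
    qed (simp add: coeff_eq_0)
    then have "\<exists>q. of_int q = 2 ^ m * coeff P i" for i by (metis Ints_cases)
    then obtain q where q: "\<And>i. of_int (q i) = 2 ^ m * coeff P i" by metis
    have "\<forall>\<^sub>\<infinity>i. q i = 0"
      using MOST_coeff_eq_0[of P] by (rule MOST_mono) (metis q mult_zero_right of_int_eq_0_iff)
    then have "coeff (Abs_poly q) = q" by (rule Abs_poly_inverse[unfolded mem_Collect_eq])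
    then have "smult (2 ^ m) P = map_poly of_int (Abs_poly q)"
      by (intro poly_eqI) (simp add: coeff_map_poly q)
    then show ?thesis by blast
  qed
  then show ?thesis by blast
qed

lemma map_poly_of_int_mult:
  "map_poly of_int (P * Q) = (map_poly of_int P * map_poly of_int Q :: rat poly)"
  by (intro poly_eqI) (simp add: coeff_map_poly coeff_mult of_int_sum)

lemma map_poly_of_int_diff:
  "map_poly of_int (P - Q) = (map_poly of_int P - map_poly of_int Q :: rat poly)"
  by (intro poly_eqI) (simp add: coeff_map_poly)

section \<open>Units and linear norms over Z[1/2]\<close>

context monic_quartic begin

text \<open>Changing the sign of \<open>g\<close> exchanges the unit with its inverse; the one of
  positive degree is taken.\<close>

lemma pellian_unit:
  assumes "pellian d"
  obtains k a f g where "balanced k a f g" "f\<^sup>2 - d * g\<^sup>2 = 1"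
proof -
  obtain f g where fg: "g \<noteq> 0" "f\<^sup>2 - d * g\<^sup>2 = 1" using assms by (auto simp: pellian_def)
  then obtain s where "s \<in> {1, -1}" "balanced (degree f) (lead_coeff f) f (smult s g)"
    using balanced_if_norm_small[of f g] by (metis degree_1 zero_le)
  moreover from this have "f\<^sup>2 - d * (smult s g)\<^sup>2 = 1" using fg(2) by auto
  ultimately show ?thesis using that by blast
qed

lemma pellian_leading:
  assumes "balanced k a f g" "f\<^sup>2 - d * g\<^sup>2 = 1"
  shows "\<exists>n. a dvd 2 ^ n"
proof -
  obtain n S where "sqrt_approx (2 * k) (2 ^ n) S" using sqrt_approx_dyadic by blast
  then have "2 * a dvd 2 ^ n" using sqrt_approx_leading assms by blast
  then show ?thesis by (metis dvd_mult_right)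
qed

text \<open>With an integral series for \<open>sqrt d\<close> the inverse of a unit would have an
  integral leading coefficient \<open>1 / (2 * a)\<close>.\<close>

lemma not_pellian_if_square_mod_4:
  assumes d: "d = A\<^sup>2 + 4 * r" "degree A = 2" "lead_coeff A = 1" "degree r \<le> 1"
  shows "\<not> pellian d"
proof
  assume "pellian d"
  then obtain k a f g where u: "balanced k a f g" "f\<^sup>2 - d * g\<^sup>2 = 1" by (rule pellian_unit)
  obtain S where "sqrt_approx (2 * k) 1 S" using sqrt_approx_integral[OF d] by blast
  then have "2 * a dvd 1" using sqrt_approx_leading u by blast
  then show False by (metis dvd_mult_left odd_one)
qed

text \<open>Clearing denominators by \<open>2 ^ n\<close> multiplies the norm by
  \<open>4 ^ n\<close>, which does not matter in \<open>Z[1/2]\<close>. Then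
  \<open>norm_linear_coeff\<close> excludes each odd prime from the linear coefficient.\<close>

lemma norm_linear_coeff_dyadic:
  fixes F G :: "rat poly"
  assumes pell: "pellian d" and dy: "dyadic_poly F" "dyadic_poly G"
    and lead: "dyadic_unit (lead_coeff F)"
    and norm: "F\<^sup>2 - map_poly of_int d * G\<^sup>2 = [:mu, lam:]" and lam: "lam \<noteq> 0"
  shows "dyadic_unit lam"
proof -
  obtain n where n: "\<exists>F'. smult (2 ^ n) F = map_poly of_int F'" "\<exists>G'. smult (2 ^ n) G = map_poly of_int G'"
    using dyadic_poly_integral[OF dy(1)] dyadic_poly_integral[OF dy(2)] by (meson max.cobounded1 max.cobounded2)
  then obtain F' G' where F': "smult (2 ^ n) F = map_poly of_int F'"
    and G': "smult (2 ^ n) G = map_poly of_int G'" by blast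
  define N where "N = F'\<^sup>2 - d * G'\<^sup>2"
  have "map_poly of_int N = (smult (2 ^ n) F)\<^sup>2 - map_poly of_int d * (smult (2 ^ n) G)\<^sup>2"
    by (simp add: N_def map_poly_of_int_diff map_poly_of_int_mult power2_eq_square F' G')
  also have "\<dots> = smult (4 ^ n) (F\<^sup>2 - map_poly of_int d * G\<^sup>2)"
    by (simp add: power2_eq_square smult_diff_right power_mult_distrib[symmetric])
  finally have N: "map_poly of_int N = smult (4 ^ n) [:mu, lam:]" unfolding norm .
  have coeffN: "of_int (coeff N i) = 4 ^ n * coeff [:mu, lam:] i" for i
    using arg_cong[OF N, of "\<lambda>P. coeff P i"] by (simp only: coeff_map_poly of_int_0 coeff_smult)
  have N': "N = [:coeff N 0, coeff N 1:]"
  proof (rule poly_eqI)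
    fix i
    have "coeff N i = 0" if "i \<ge> 2"
      using coeffN[of i] that by (simp add: coeff_pCons split: nat.splits)
    then show "coeff N i = coeff [:coeff N 0, coeff N 1:] i"
      by (auto simp: coeff_pCons split: nat.splits)
  qed
  have lamN: "of_int (coeff N 1) = 4 ^ n * lam" using coeffN[of 1] by simp
  with lam have N1: "coeff N 1 \<noteq> 0" by auto
  \<comment> \<open>Otherwise the linear norm would be \<open>F'^2\<close>, of even degree.\<close>
  have "G' \<noteq> 0"
  proof
    assume "G' = 0"
    then have "degree N = 2 * degree F'"
      by (cases "F' = 0") (simp_all add: N_def degree_power_eq)
    moreover have "degree N = 1" using N1 by (subst N') simp
    ultimately show False by presburger
  qed
  have norm': "F'\<^sup>2 - d * G'\<^sup>2 = [:coeff N 0, coeff N 1:]"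
    using N' by (simp add: N_def)
  have "degree (F'\<^sup>2 - d * G'\<^sup>2) \<le> 1" unfolding norm' by simp
  then obtain s where s: "s \<in> {1, -1}" "balanced (degree F') (lead_coeff F') F' (smult s G')"
    using balanced_if_norm_small \<open>G' \<noteq> 0\<close> by blast
  have norms: "F'\<^sup>2 - d * (smult s G')\<^sup>2 = [:coeff N 0, coeff N 1:]"
    using s(1) norm' by auto
  have "of_int (lead_coeff F') = 2 ^ n * lead_coeff F"
  proof -
    have "degree F' = degree F" using arg_cong[OF F', of degree]
      by (simp add: degree_map_poly)
    then show ?thesis using arg_cong[OF F', of "\<lambda>P. coeff P (degree F)"] by (simp add: coeff_map_poly)
  qed
  then have "dyadic_unit (of_int (lead_coeff F'))"
    using lead by (simp add: dyadic_unit_mult dyadic_unit_power2)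
  then obtain j where j: "lead_coeff F' dvd 2 ^ j" by (auto simp: dyadic_unit_of_int_iff)
  obtain k a f g where u: "balanced k a f g" "f\<^sup>2 - d * g\<^sup>2 = 1" using pellian_unit[OF pell] .
  obtain i where i: "a dvd 2 ^ i" using pellian_leading[OF u] by blast
  have "\<not> int p dvd coeff N 1" if p: "prime p" "p > 2" for p
  proof (rule norm_linear_coeff[OF p u _ s(2) norms _ N1])
    have "\<not> int p dvd 2 ^ m" for m
      using p by (metis prime_dvd_power prime_nat_int_transfer zdvd_imp_le zero_less_numeral not_less of_nat_less_iff of_nat_numeral)
    then show "\<not> int p dvd a" "\<not> int p dvd lead_coeff F'"
      using i j dvd_trans by blast+
  qed
  then have "dyadic_unit (4 ^ n * lam)"
    unfolding lamN[symmetric] dyadic_unit_of_int_iff using N1 by (intro dvd_power2_if_no_odd_prime)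
  moreover have "dyadic_unit (1 / 4 ^ n)"
    using dyadic_unit_power2[of "2 * n"] by (auto simp: dyadic_unit_def power_mult)
  ultimately have "dyadic_unit (1 / 4 ^ n * (4 ^ n * lam))" by (metis dyadic_unit_mult)
  moreover have "1 / 4 ^ n * (4 ^ n * lam) = lam" by simp
  ultimately show ?thesis by (simp only:)
qed

end

section \<open>Norms of the first convergents\<close>

text \<open>
  With \<open>A = z\<^sup>2 + b\<close> and \<open>d = A\<^sup>2 + \<alpha> z + \<beta>\<close> the element \<open>A G + K + G \<surd>d\<close> has norm
  \<open>K\<^sup>2 + 2 A G K - G\<^sup>2 (\<alpha> z + \<beta>)\<close>.  The pairs \<open>(G, K)\<close> below come from the second, third and fourth convergent
  of \<open>\<surd>d\<close>, cleared of denominators; the first one is \<open>(1, 0)\<close>.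
\<close>

lemma norm2_identity:
  fixes z al be b :: rat
  assumes "ga = al\<^sup>2 * b + be\<^sup>2"
  shows "(al\<^sup>2)\<^sup>2 + 2 * (z\<^sup>2 + b) * (2 * al * z - 2 * be) * al\<^sup>2 - (2 * al * z - 2 * be)\<^sup>2 * (al * z + be)
    = 4 * al * ga * z + (al ^ 4 - 4 * be * ga)"
  unfolding assms by algebra

lemma norm3_identity:
  fixes z al be b ga de :: rat
  assumes ga: "ga = al\<^sup>2 * b + be\<^sup>2" and de: "de = 8 * be * ga - al ^ 4"
    and K: "K = 4 * al * ga * z + (4 * be * ga - al ^ 4)"
    and G: "G = 8 * ga * z\<^sup>2 - 2 * al ^ 3 * z + (8 * ga * b + 2 * al\<^sup>2 * be)"
    and mu: "mu = 32 * ga\<^sup>2 * be\<^sup>2 - 16 * ga ^ 3 - 12 * al ^ 4 * be * ga + al ^ 8"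
  shows "K\<^sup>2 + 2 * (z\<^sup>2 + b) * G * K - G\<^sup>2 * (al * z + be) = 4 * al * ga * de * z + mu"
  unfolding K G mu de unfolding ga by algebra

text \<open>The polarization of the norm form at the third pair \<open>(G, K)\<close> and the second
  pair \<open>(G', al^2)\<close>.\<close>

lemma cross_identity:
  fixes z al be b ga de :: rat
  assumes ga: "ga = al\<^sup>2 * b + be\<^sup>2" and de: "de = 8 * be * ga - al ^ 4"
    and K: "K = 4 * al * ga * z + (4 * be * ga - al ^ 4)"
    and G: "G = 8 * ga * z\<^sup>2 - 2 * al ^ 3 * z + (8 * ga * b + 2 * al\<^sup>2 * be)"
    and G': "G' = 2 * al * z - 2 * be"
  shows "K * al\<^sup>2 + (z\<^sup>2 + b) * (G * al\<^sup>2 + G' * K) - G * G' * (al * z + be)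
    = 8 * ga\<^sup>2 * (z\<^sup>2 + b) + al\<^sup>2 * de"
  unfolding K G G' de unfolding ga by algebra

text \<open>The fourth pair arises from the third and second by the recursion for convergents, with
  partial quotient proportional to \<open>L\<close>. Its norm is therefore a combination of the two
  earlier norms and their polarization.\<close>

lemma norm4_identity:
  fixes z al be b ga de :: rat
  assumes ga: "ga = al\<^sup>2 * b + be\<^sup>2" and de: "de = 8 * be * ga - al ^ 4"
    and K: "K = 4 * al * ga * z + (4 * be * ga - al ^ 4)"
    and G: "G = 8 * ga * z\<^sup>2 - 2 * al ^ 3 * z + (8 * ga * b + 2 * al\<^sup>2 * be)"
    and G': "G' = 2 * al * z - 2 * be"
    and mu: "mu = 32 * ga\<^sup>2 * be\<^sup>2 - 16 * ga ^ 3 - 12 * al ^ 4 * be * ga + al ^ 8"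
    and L: "L = 4 * al * ga * de * z - mu"
    and K4: "K4 = L * K - al\<^sup>2 * de\<^sup>2 * al\<^sup>2" and G4: "G4 = L * G - al\<^sup>2 * de\<^sup>2 * G'"
  shows "K4\<^sup>2 + 2 * (z\<^sup>2 + b) * G4 * K4 - G4\<^sup>2 * (al * z + be)
    = - 64 * al * ga ^ 4 * de * (16 * ga ^ 3 + al ^ 4 * de) * z
      + (mu ^ 3 + al ^ 4 * de ^ 4 * (al ^ 4 - 4 * be * ga) + 2 * mu * al\<^sup>2 * de\<^sup>2 * (8 * ga\<^sup>2 * b + al\<^sup>2 * de))"
proof -
  define N2 where "N2 = 4 * al * ga * z + (al ^ 4 - 4 * be * ga)"
  define N3 where "N3 = 4 * al * ga * de * z + mu"
  define X where "X = 8 * ga\<^sup>2 * (z\<^sup>2 + b) + al\<^sup>2 * de"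
  have N2: "(al\<^sup>2)\<^sup>2 + 2 * (z\<^sup>2 + b) * G' * al\<^sup>2 - G'\<^sup>2 * (al * z + be) = N2"
    unfolding N2_def G' using norm2_identity[OF ga] .
  have N3: "K\<^sup>2 + 2 * (z\<^sup>2 + b) * G * K - G\<^sup>2 * (al * z + be) = N3"
    unfolding N3_def using norm3_identity[OF ga de K G mu] .
  have X: "K * al\<^sup>2 + (z\<^sup>2 + b) * (G * al\<^sup>2 + G' * K) - G * G' * (al * z + be) = X"
    unfolding X_def using cross_identity[OF ga de K G G'] .
  have "K4\<^sup>2 + 2 * (z\<^sup>2 + b) * G4 * K4 - G4\<^sup>2 * (al * z + be)
    = L\<^sup>2 * N3 + (al\<^sup>2 * de\<^sup>2)\<^sup>2 * N2 - 2 * L * (al\<^sup>2 * de\<^sup>2) * X"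
    unfolding N2[symmetric] N3[symmetric] X[symmetric] K4 G4 by algebra
  \<comment> \<open>\<open>L\<close> is \<open>N3\<close> with the constant term negated, so
    \<open>L * N3 - 2 * al^2 * de^2 * X\<close> is constant and the whole expression linear in
    \<open>z\<close>.\<close>
  also have "\<dots> = (- (4 * al * ga * de) * (mu\<^sup>2 + al ^ 4 * de ^ 3 + 16 * ga\<^sup>2 * de\<^sup>2 * (al\<^sup>2 * b))) * z
      + (mu ^ 3 + al ^ 4 * de ^ 4 * (al ^ 4 - 4 * be * ga) + 2 * mu * al\<^sup>2 * de\<^sup>2 * (8 * ga\<^sup>2 * b + al\<^sup>2 * de))"
    unfolding N2_def N3_def X_def L by algebra
  also have "al\<^sup>2 * b = ga - be\<^sup>2" using ga by simp
  also have "mu\<^sup>2 + al ^ 4 * de ^ 3 + 16 * ga\<^sup>2 * de\<^sup>2 * (ga - be\<^sup>2) = 16 * ga ^ 3 * (16 * ga ^ 3 + al ^ 4 * de)"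
    unfolding mu de by algebra
  finally show ?thesis by (simp add: mult_ac power_eq_if)
qed

section \<open>Unit conditions on the coefficients of d\<close>

context monic_quartic begin

text \<open>
  Completing the square: \<open>d = (z\<^sup>2 + b)\<^sup>2 + al z + be\<close> with \<open>z = x + h\<close>.
\<close>

definition h :: rat where "h = of_int (coeff d 3) / 4"
definition b :: rat where "b = of_int (coeff d 2) / 2 - 3 * h\<^sup>2"
definition al :: rat where "al = of_int (coeff d 1) - 2 * of_int (coeff d 2) * h + 8 * h ^ 3"
definition be :: rat where "be = of_int (coeff d 0) - (h\<^sup>2 + b)\<^sup>2 - al * h"
text \<open>For nonzero \<open>al\<close> this is \<open>al^2\<close> times the value of
  \<open>z^2 + b\<close> at the root of \<open>al * z + be\<close>; it vanishes iff
  \<open>al * z + be\<close> divides \<open>z^2 + b\<close>.\<close>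

definition ga :: rat where "ga = al\<^sup>2 * b + be\<^sup>2"
text \<open>Up to the factor \<open>4 * al * ga\<close>, the linear coefficient of the norm of the
  third pair.\<close>

definition de :: rat where "de = 8 * be * ga - al ^ 4"

lemma poly_d: "poly (map_poly of_int d) x = ((x + h)\<^sup>2 + b)\<^sup>2 + al * (x + h) + be"
proof -
  have h: "of_int (coeff d 3) = 4 * h" by (simp add: h_def)
  have c2: "of_int (coeff d 2) = 2 * b + 6 * h\<^sup>2" by (simp add: b_def)
  have "poly (map_poly of_int d) x = of_int (coeff d 0) + x * (of_int (coeff d 1) + x *
    (of_int (coeff d 2) + x * (of_int (coeff d 3) + x)))"
    by (subst d_expand) (simp add: map_poly_pCons)
  also have "\<dots> = ((x + h)\<^sup>2 + b)\<^sup>2 + al * (x + h) + be"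
    unfolding h be_def al_def c2 by algebra
  finally show ?thesis .
qed

lemma dyadic_params: "dyadic h" "dyadic b" "dyadic al" "dyadic be" "dyadic ga" "dyadic de"
proof -
  have d2: "dyadic (of_int k / 2)" and d4: "dyadic (of_int k / 4)" for k
    using dyadic_divide_power2[of "of_int k" 1] dyadic_divide_power2[of "of_int k" 2] by auto
  show h: "dyadic h" unfolding h_def by (rule d4)
  show b: "dyadic b" unfolding b_def by (intro dyadic_diff dyadic_mult dyadic_power d2 h) simp
  show al: "dyadic al" unfolding al_def
    by (intro dyadic_diff dyadic_add dyadic_mult dyadic_power h) simp_all
  show be: "dyadic be" unfolding be_def
    by (intro dyadic_diff dyadic_add dyadic_mult dyadic_power h b al) simp_all
  show ga: "dyadic ga" unfolding ga_def by (intro dyadic_add dyadic_mult dyadic_power b al be)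
  show "dyadic de" unfolding de_def by (intro dyadic_diff dyadic_mult dyadic_power al be ga) simp
qed

text \<open>With \<open>F = A * G + K\<close> and \<open>d = A^2 + al * z + be\<close>, the norm of
  \<open>F + G * sqrt d\<close> takes the displayed form. The degree condition gives
  \<open>F\<close> the leading coefficient of \<open>G\<close>, and the shift by \<open>h\<close>
  preserves \<open>lam\<close>.\<close>

lemma norm_linear_coeff_shifted:
  assumes pell: "pellian d" and dy: "dyadic_poly G" "dyadic_poly K"
    and deg: "degree K < degree G + 2" and lead: "dyadic_unit (lead_coeff G)"
    and norm: "\<And>x. (poly K x)\<^sup>2 + 2 * ((x + h)\<^sup>2 + b) * poly G x * poly K x
        - (poly G x)\<^sup>2 * (al * (x + h) + be) = lam * (x + h) + mu"
    and lam: "lam \<noteq> 0"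
  shows "dyadic_unit lam"
proof -
  define A where "A = [:h, 1:]\<^sup>2 + [:b:]"
  define F where "F = A * G + K"
  have A: "degree A = 2" "lead_coeff A = 1" "poly A x = (x + h)\<^sup>2 + b" for x
    by (simp_all add: A_def power2_eq_square algebra_simps)
  have "G \<noteq> 0" using lead by (auto simp: dyadic_unit_def)
  then have "degree (A * G) = degree G + 2" using A by (subst degree_mult_eq) auto
  then have "lead_coeff F = lead_coeff (A * G)"
    using deg lead_coeff_add_le[of K "A * G"] by (simp add: F_def add.commute)
  also have "\<dots> = lead_coeff G" unfolding lead_coeff_mult A(2) by simp
  finally have leadF: "lead_coeff F = lead_coeff G" .
  have dyA: "dyadic_poly A"
    unfolding A_def power2_eq_square by (intro dyadic_poly_intros dyadic_params) simp_all
  show ?thesis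
  proof (rule norm_linear_coeff_dyadic[OF pell _ dy(1) _ _ lam])
    show "dyadic_poly F" unfolding F_def by (intro dyadic_poly_intros dyA dy)
    show "dyadic_unit (lead_coeff F)" unfolding leadF by (rule lead)
    show "F\<^sup>2 - map_poly of_int d * G\<^sup>2 = [:mu + lam * h, lam:]"
    proof (rule poly_eq_poly_eq_iff[THEN iffD1], rule ext)
      fix x
      have "poly (F\<^sup>2 - map_poly of_int d * G\<^sup>2) x
        = (poly K x)\<^sup>2 + 2 * ((x + h)\<^sup>2 + b) * poly G x * poly K x
        - (poly G x)\<^sup>2 * (al * (x + h) + be)"
        unfolding poly_diff poly_mult poly_power F_def poly_add A(3) poly_d by algebra
      then show "poly (F\<^sup>2 - map_poly of_int d * G\<^sup>2) x = poly [:mu + lam * h, lam:] x"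
        unfolding norm by (simp add: algebra_simps)
    qed
  qed
qed

text \<open>\<open>A + sqrt d\<close> has norm \<open>- (al * z + be)\<close>.\<close>

lemma al_dyadic_unit:
  assumes "pellian d" "al \<noteq> 0" shows "dyadic_unit al"
proof -
  have "dyadic_unit (- al)"
    by (rule norm_linear_coeff_shifted[OF assms(1), of 1 0 _ "- be"])
      (use assms(2) dyadic_unit_power2[of 0] in \<open>auto simp: one_pCons intro!: dyadic_poly_intros\<close>)
  then show ?thesis by (simp add: dyadic_unit_minus)
qed

text \<open>The unit conditions build on one another: the second pair is admissible because its
  leading coefficient \<open>2 * al\<close> is already known to be a unit.\<close>

lemma ga_dyadic_unit:
  assumes "pellian d" "al \<noteq> 0" "ga \<noteq> 0" shows "dyadic_unit ga"
proof -
  define G where "G = [:2 * al:] * [:h, 1:] - [:2 * be:]"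
  define K where "K = [:al\<^sup>2:]"
  have G: "G = [:2 * al * h - 2 * be, 2 * al:]" by (simp add: G_def)
  have u2: "dyadic_unit 2" using dyadic_unit_power2[of 1] by simp
  have "dyadic_unit (4 * al * ga)"
  proof (rule norm_linear_coeff_shifted[OF assms(1)])
    show "dyadic_poly G" "dyadic_poly K"
      unfolding G_def K_def by (intro dyadic_poly_intros dyadic_params dyadic_mult dyadic_power; simp)+
    show "degree K < degree G + 2" using assms by (simp add: G K_def)
    show "dyadic_unit (lead_coeff G)"
      using assms dyadic_unit_mult[OF u2 al_dyadic_unit] by (simp add: G)
    show "4 * al * ga \<noteq> 0" using assms by simp
    fix x
    have "poly G x = 2 * al * (x + h) - 2 * be" "poly K x = al\<^sup>2"
      by (simp_all add: G_def K_def algebra_simps)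
    then show "(poly K x)\<^sup>2 + 2 * ((x + h)\<^sup>2 + b) * poly G x * poly K x
        - (poly G x)\<^sup>2 * (al * (x + h) + be) = 4 * al * ga * (x + h) + (al ^ 4 - 4 * be * ga)"
      using norm2_identity[OF ga_def, of "x + h"] by simp
  qed
  then show ?thesis
    by (rule dyadic_unit_multD) (intro dyadic_params dyadic_mult; simp)+
qed

text \<open>The third pair has leading coefficient \<open>8 * ga\<close> and yields
  \<open>de\<close>; the fourth has leading coefficient \<open>32 * al * ga^2 * de\<close> and
  yields the last condition.\<close>

lemma de_dyadic_unit:
  assumes "pellian d" "al \<noteq> 0" "ga \<noteq> 0" "de \<noteq> 0" shows "dyadic_unit de"
    and "16 * ga ^ 3 + al ^ 4 * de \<noteq> 0 \<Longrightarrow> dyadic_unit (16 * ga ^ 3 + al ^ 4 * de)"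
proof -
  define mu where "mu = 32 * ga\<^sup>2 * be\<^sup>2 - 16 * ga ^ 3 - 12 * al ^ 4 * be * ga + al ^ 8"
  define G where "G = [:8 * ga:] * [:h, 1:]\<^sup>2 - [:2 * al ^ 3:] * [:h, 1:] + [:8 * ga * b + 2 * al\<^sup>2 * be:]"
  define K where "K = [:4 * al * ga:] * [:h, 1:] + [:4 * be * ga - al ^ 4:]"
  have "\<exists>g0 g1. G = [:g0, g1, 8 * ga:]" "\<exists>k0. K = [:k0, 4 * al * ga:]"
    by (simp_all add: G_def K_def power2_eq_square)
  then obtain g0 g1 k0 where G: "G = [:g0, g1, 8 * ga:]" and K: "K = [:k0, 4 * al * ga:]" by blast
  have u2: "dyadic_unit (2 ^ n)" for n by (rule dyadic_unit_power2)
  have dmu: "dyadic mu"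
    unfolding mu_def by (intro dyadic_add dyadic_diff dyadic_mult dyadic_power dyadic_params; simp)
  have dyG: "dyadic_poly G" and dyK: "dyadic_poly K"
    unfolding G_def K_def power2_eq_square
    by (intro dyadic_poly_intros dyadic_params dyadic_add dyadic_diff dyadic_mult dyadic_power; simp)+
  have polyG: "poly G x = 8 * ga * (x + h)\<^sup>2 - 2 * al ^ 3 * (x + h) + (8 * ga * b + 2 * al\<^sup>2 * be)"
    and polyK: "poly K x = 4 * al * ga * (x + h) + (4 * be * ga - al ^ 4)" for x
    by (simp_all add: G_def K_def algebra_simps)
  have "dyadic_unit (4 * al * ga * de)"
  proof (rule norm_linear_coeff_shifted[OF assms(1) dyG dyK])
    show "degree K < degree G + 2" using assms by (simp add: G K)
    show "dyadic_unit (lead_coeff G)"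
      using assms dyadic_unit_mult[OF u2[of 3] ga_dyadic_unit] by (simp add: G)
    show "4 * al * ga * de \<noteq> 0" using assms by simp
    show "(poly K x)\<^sup>2 + 2 * ((x + h)\<^sup>2 + b) * poly G x * poly K x
        - (poly G x)\<^sup>2 * (al * (x + h) + be) = 4 * al * ga * de * (x + h) + mu" for x
      by (rule norm3_identity[OF ga_def de_def polyK polyG mu_def])
  qed
  then show de: "dyadic_unit de"
    by (rule dyadic_unit_multD) (intro dyadic_params dyadic_mult; simp)+
  define L where "L = [:4 * al * ga * de:] * [:h, 1:] - [:mu:]"
  have "\<exists>l0. L = [:l0, 4 * al * ga * de:]" by (simp add: L_def)
  then obtain l0 where L: "L = [:l0, 4 * al * ga * de:]" by blast
  have polyL: "poly L x = 4 * al * ga * de * (x + h) - mu" for x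
    by (simp add: L_def algebra_simps)
  define G' where "G' = [:2 * al:] * [:h, 1:] - [:2 * be:]"
  have polyG': "poly G' x = 2 * al * (x + h) - 2 * be" for x
    by (simp add: G'_def algebra_simps)
  define G4 where "G4 = L * G - [:al\<^sup>2 * de\<^sup>2:] * G'"
  define K4 where "K4 = L * K - [:al\<^sup>2 * de\<^sup>2 * al\<^sup>2:]"
  have "\<exists>g0 g1 g2. G4 = [:g0, g1, g2, 4 * al * ga * de * (8 * ga):]" "\<exists>k0 k1. K4 = [:k0, k1, 4 * al * ga * de * (4 * al * ga):]"
    by (simp_all add: G4_def K4_def G'_def G K L)
  then obtain g0' g1' g2' k0' k1' where G4: "G4 = [:g0', g1', g2', 4 * al * ga * de * (8 * ga):]"
    and K4: "K4 = [:k0', k1', 4 * al * ga * de * (4 * al * ga):]" by blast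
  assume W: "16 * ga ^ 3 + al ^ 4 * de \<noteq> 0"
  have "dyadic_unit (- 64 * al * ga ^ 4 * de * (16 * ga ^ 3 + al ^ 4 * de))"
  proof (rule norm_linear_coeff_shifted[OF assms(1)])
    show "dyadic_poly G4" "dyadic_poly K4"
      unfolding G4_def K4_def G'_def L_def
      by (intro dyadic_poly_intros dyadic_params dmu dyG dyK dyadic_add dyadic_diff dyadic_mult dyadic_power; simp)+
    show "degree K4 < degree G4 + 2" using assms by (simp add: G4 K4)
    have "dyadic_unit (2 ^ 5 * (al * (ga * (de * ga))))"
      using assms by (intro dyadic_unit_mult u2 al_dyadic_unit ga_dyadic_unit de)
    then show "dyadic_unit (lead_coeff G4)" using assms by (simp add: G4 mult_ac)
    show "- 64 * al * ga ^ 4 * de * (16 * ga ^ 3 + al ^ 4 * de) \<noteq> 0" using assms W by simp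
    fix x
    have "poly K4 x = poly L x * poly K x - al\<^sup>2 * de\<^sup>2 * al\<^sup>2"
      "poly G4 x = poly L x * poly G x - al\<^sup>2 * de\<^sup>2 * poly G' x"
      by (simp_all add: K4_def G4_def)
    then show "(poly K4 x)\<^sup>2 + 2 * ((x + h)\<^sup>2 + b) * poly G4 x * poly K4 x
        - (poly G4 x)\<^sup>2 * (al * (x + h) + be) = - 64 * al * ga ^ 4 * de * (16 * ga ^ 3 + al ^ 4 * de) * (x + h)
      + (mu ^ 3 + al ^ 4 * de ^ 4 * (al ^ 4 - 4 * be * ga) + 2 * mu * al\<^sup>2 * de\<^sup>2 * (8 * ga\<^sup>2 * b + al\<^sup>2 * de))"
      by (rule norm4_identity[OF ga_def de_def polyK polyG polyG' mu_def polyL])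
  qed
  then show "dyadic_unit (16 * ga ^ 3 + al ^ 4 * de)"
    by (rule dyadic_unit_multD) (intro dyadic_params dyadic_mult dyadic_add dyadic_power dyadic_minus; simp)+
qed

end

section \<open>Parity discussion\<close>

lemma dyadic_unit_odd_part:
  assumes "dyadic_unit q" "2 ^ n * q = of_int (2 ^ m * k)" "odd k"
  shows "k = 1 \<or> k = - 1"
proof -
  have "dyadic_unit (2 ^ m * of_int k)"
    using dyadic_unit_mult[OF dyadic_unit_power2 assms(1), of n] assms(2) by simp
  then have "dyadic_unit (of_int k)"
    by (rule dyadic_unit_multD) (auto intro: dyadic_power)
  then obtain i where "k dvd 2 ^ i" by (auto simp: dyadic_unit_of_int_iff)
  with assms(3) have "\<bar>k\<bar> = 1" by (rule odd_dvd_power2)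
  then show ?thesis by linarith
qed

context monic_quartic begin

text \<open>\<open>8 * al\<close> is odd, hence \<open>1\<close> or \<open>-1\<close>, and its
  residue modulo \<open>4\<close> decides which. For coefficient \<open>3\<close> this contradicts
  \<open>al > 0\<close>; for coefficient \<open>1\<close> it gives \<open>al = 1 / 8\<close>, and
  then \<open>2 ^ 12 * ga\<close> is \<open>5\<close> modulo \<open>8\<close>.\<close>

lemma not_pellian_if_coeff_3_odd:
  assumes "coeff d 3 = 1 \<or> coeff d 3 = 3" "al > 0" "ga \<noteq> 0"
  shows "\<not> pellian d"
proof
  assume pell: "pellian d"
  define r q p where "r = coeff d 0" "q = coeff d 1" "p = coeff d 2"
  note rqp = this
  have du_al: "dyadic_unit al" using pell assms al_dyadic_unit by simp
  show False using assms(1)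
  proof
    assume c3: "coeff d 3 = 3"
    have "2 ^ 3 * al = of_int (2 ^ 0 * (8 * q - 12 * p + 27))"
      by (simp add: al_def h_def c3 rqp field_simps power_eq_if)
    from dyadic_unit_odd_part[OF du_al this] have "8 * q - 12 * p + 27 = 1 \<or> 8 * q - 12 * p + 27 = -1"
      by simp
    then have "8 * q - 12 * p + 27 = 1"
      using assms(2) by (auto simp: al_def h_def c3 rqp field_simps power_eq_if)
    then show False by presburger
  next
    assume c3: "coeff d 3 = 1"
    have al8: "2 ^ 3 * al = of_int (2 ^ 0 * (8 * q - 4 * p + 1))"
      by (simp add: al_def h_def c3 rqp field_simps power_eq_if)
    from dyadic_unit_odd_part[OF du_al this] have "8 * q - 4 * p + 1 = 1 \<or> 8 * q - 4 * p + 1 = -1"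
      by simp
    then have p: "p = 2 * q" by presburger
    have al: "al = 1 / 8" using al8 p by simp
    have b: "b = of_int q - 3 / 16" using p by (simp add: b_def h_def c3 rqp field_simps power_eq_if)
    define m where "m = 4 * r - 4 * q\<^sup>2 + q"
    have be: "64 * be = 16 * of_int m - 3"
      by (simp add: be_def al b h_def c3 rqp m_def field_simps power_eq_if)
    have "4096 * ga = 64 * b + (64 * be)\<^sup>2"
      by (simp add: ga_def al field_simps power_eq_if)
    define X where "X = 8 * q - 12 * m + 32 * m\<^sup>2"
    note \<open>4096 * ga = 64 * b + (64 * be)\<^sup>2\<close>
    also have "64 * b + (64 * be)\<^sup>2 = of_int (2 ^ 0 * (8 * X - 3))"
      unfolding be b X_def by (simp add: power2_eq_square algebra_simps)
    also have "4096 = (2::rat) ^ 12" by simp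
    finally have "2 ^ 12 * ga = of_int (2 ^ 0 * (8 * X - 3))" .
    from dyadic_unit_odd_part[OF _ this] have "8 * X - 3 = 1 \<or> 8 * X - 3 = -1"
      using ga_dyadic_unit[OF pell] assms by simp
    then show False by presburger
  qed
qed

text \<open>Splitting powers of \<open>2\<close> off the four unit conditions leaves odd integers
  that must be \<open>1\<close> or \<open>-1\<close>. Congruences fix the signs, and the resulting
  equations are contradictory.\<close>

lemma not_pellian_if_coeff_3_zero:
  assumes c3: "coeff d 3 = 0" and pos: "al > 0" "ga \<noteq> 0"
  shows "\<not> pellian d"
proof
  assume pell: "pellian d"
  define r q p where "r = coeff d 0" "q = coeff d 1" "p = coeff d 2"
  note rqp = this
  have al: "al = of_int q" by (simp add: al_def h_def c3 rqp)
  have b: "b = of_int p / 2" by (simp add: b_def h_def c3 rqp)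
  have be: "be = of_int r - (of_int p)\<^sup>2 / 4" by (simp add: be_def b h_def c3 rqp power_divide)
  have q: "q > 0" using pos al by simp
  have du_al: "dyadic_unit al" and du_ga: "dyadic_unit ga"
    and du_de: "de \<noteq> 0 \<Longrightarrow> dyadic_unit de"
    and du_W: "de \<noteq> 0 \<Longrightarrow> 16 * ga ^ 3 + al ^ 4 * de \<noteq> 0 \<Longrightarrow> dyadic_unit (16 * ga ^ 3 + al ^ 4 * de)"
    using pell pos al_dyadic_unit ga_dyadic_unit de_dyadic_unit by auto
  show False
  proof (cases "even p")
    case False
    \<comment> \<open>\<open>w\<close> is \<open>4 * be\<close>. The conditions on \<open>ga\<close>
      and \<open>de\<close> express \<open>w\<close> and then \<open>p\<close> through
      \<open>q\<close>, and \<open>p\<close> comes out even.\<close>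
    define w where "w = 4 * r - p\<^sup>2"
    have w: "odd w" using False by (simp add: w_def)
    then obtain k where k: "w = 2 * k + 1" by (elim oddE)
    have be: "be = of_int w / 4" by (simp add: be w_def field_simps)
    have "2 ^ 4 * ga = of_int (2 ^ 0 * (8 * q\<^sup>2 * p + w\<^sup>2))"
      by (simp add: ga_def al b be field_simps power_eq_if)
    from dyadic_unit_odd_part[OF du_ga this] w have "8 * q\<^sup>2 * p + w\<^sup>2 = 1 \<or> 8 * q\<^sup>2 * p + w\<^sup>2 = -1"
      by simp
    moreover have "8 * q\<^sup>2 * p + w\<^sup>2 = 4 * (2 * q\<^sup>2 * p + k\<^sup>2 + k) + 1" unfolding k by algebra
    ultimately have g: "8 * q\<^sup>2 * p + w\<^sup>2 = 1" by presburger
    have ga: "ga = 1 / 16" using g \<open>2 ^ 4 * ga = _\<close> by simp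
    have de: "2 ^ 3 * de = of_int (2 ^ 0 * (w - 8 * q ^ 4))"
      by (simp add: de_def ga be al)
    have "odd (w - 8 * q ^ 4)" using w by simp
    moreover have "de \<noteq> 0"
    proof
      assume "de = 0"
      then have "of_int (2 ^ 0 * (w - 8 * q ^ 4)) = (0::rat)" using de by (simp only: mult_zero_right)
      then have "w - 8 * q ^ 4 = 0" by (simp only: of_int_eq_0_iff power_0 mult_1)
      with \<open>odd (w - 8 * q ^ 4)\<close> show False by simp
    qed
    ultimately have "w - 8 * q ^ 4 = 1 \<or> w - 8 * q ^ 4 = -1"
      using dyadic_unit_odd_part[OF du_de de] by blast
    then obtain s where s: "w = 8 * q ^ 4 + s" "s\<^sup>2 = 1" by (metis add.commute diff_add_cancel one_power2 power2_minus)
    have "8 * q\<^sup>2 * (p + (8 * q ^ 6 + 2 * s * q\<^sup>2)) = 0"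
      using g s by algebra
    then have "p = - 2 * (4 * q ^ 6 + s * q\<^sup>2)" using q by simp
    then show False using False by simp
  next
    case True
    then obtain B where B: "p = 2 * B" by (elim evenE)
    define \<beta> where "\<beta> = r - B\<^sup>2"
    define g where "g = q\<^sup>2 * B + \<beta>\<^sup>2"
    have b: "b = of_int B" using b B by simp
    have be: "be = of_int \<beta>" by (simp add: be B \<beta>_def power2_eq_square)
    have ga: "ga = of_int g" by (simp add: ga_def al b be g_def)
    have de: "de = of_int (8 * \<beta> * g - q ^ 4)" by (simp add: de_def al be ga)
    have W: "16 * ga ^ 3 + al ^ 4 * de = of_int (16 * g ^ 3 + q ^ 4 * (8 * \<beta> * g - q ^ 4))"
      by (simp add: al ga de)
    have W_odd: "k = 1 \<or> k = -1" if "de \<noteq> 0" "odd k" "16 * g ^ 3 + q ^ 4 * (8 * \<beta> * g - q ^ 4) = 2 ^ m * k" for k m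
    proof (rule dyadic_unit_odd_part)
      show "dyadic_unit (16 * ga ^ 3 + al ^ 4 * de)" using that by (intro du_W) (auto simp: W)
      show "2 ^ 0 * (16 * ga ^ 3 + al ^ 4 * de) = of_int (2 ^ m * k)" unfolding W that(3) by simp
    qed fact
    have de_odd: "k = 1 \<or> k = -1" if "odd k" "8 * \<beta> * g - q ^ 4 = 2 ^ m * k" for k m
    proof (rule dyadic_unit_odd_part)
      show "dyadic_unit de" using that by (intro du_de) (auto simp: de)
      show "2 ^ 0 * de = of_int (2 ^ m * k)" unfolding de that(2) by simp
    qed fact
    have ga_odd: "k = 1 \<or> k = -1" if "odd k" "g = 2 ^ m * k" for k m
      using dyadic_unit_odd_part[OF du_ga, of 0 m k] that by (simp add: ga)
    have g0: "g \<noteq> 0" using pos ga by simp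
    have "q = 1 \<or> q = 2 \<or> 4 dvd q"
    proof (cases "odd q")
      case True
      then show ?thesis using dyadic_unit_odd_part[OF du_al, of 0 0 q] q by (auto simp: al)
    next
      case False
      then obtain k where k: "q = 2 * k" by (auto elim: evenE)
      show ?thesis
      proof (cases "odd k")
        case True
        then show ?thesis using dyadic_unit_odd_part[OF du_al, of 0 1 k] q k by (auto simp: al)
      qed (auto simp: k)
    qed
    moreover have even_if: "q = 2 \<Longrightarrow> even q" "4 dvd q \<Longrightarrow> even q"
      by presburger+
    \<comment> \<open>In the first four cases the conditions on \<open>de\<close> and on
      \<open>16 * ga ^ 3 + al ^ 4 * de\<close> are contradictory; in the last one \<open>d\<close>
      is a square plus \<open>4\<close> times a linear polynomial.\<close>
    ultimately consider "q = 1" | "q = 2" "even \<beta>" | "even q" "odd \<beta>" | "4 dvd q" "even \<beta>" "\<not> 4 dvd \<beta>" | "4 dvd q" "4 dvd \<beta>"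
      using even_if by blast
    then show False
    proof cases
      case 1
      then have "8 * \<beta> * g - 1 = 1 \<or> 8 * \<beta> * g - 1 = -1"
        using de_odd[of "8 * \<beta> * g - 1" 0] by simp
      moreover have "8 * \<beta> * g = 8 * (\<beta> * g)" by simp
      ultimately have "\<beta> * g = 0" by presburger
      then have "\<beta> = 0" using g0 by simp
      then have "g = B" using 1 by (simp add: g_def)
      have "de \<noteq> 0" using 1 \<open>\<beta> = 0\<close> by (simp add: de)
      then have "16 * B ^ 3 - 1 = 1 \<or> 16 * B ^ 3 - 1 = -1"
        using W_odd[of "16 * B ^ 3 - 1" 0] 1 \<open>\<beta> = 0\<close> \<open>g = B\<close> by simp
      then have "B ^ 3 = 0" by presburger
      then show False using g0 \<open>g = B\<close> by simp
    next
      case 2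
      then obtain \<beta>1 where \<beta>1: "\<beta> = 2 * \<beta>1" by (elim evenE)
      define g' where "g' = B + \<beta>1\<^sup>2"
      have g: "g = 4 * g'" using 2 \<beta>1 by (simp add: g_def g'_def power2_eq_square)
      have "4 * (\<beta>1 * g') - 1 = 1 \<or> 4 * (\<beta>1 * g') - 1 = -1"
        using de_odd[of "4 * (\<beta>1 * g') - 1" 4] 2 \<beta>1 g by simp
      then have "\<beta>1 * g' = 0" by presburger
      then have "\<beta>1 = 0" using g0 g by simp
      then have gB: "g = 4 * B" by (simp add: g g'_def)
      have "de \<noteq> 0" using 2 \<beta>1 \<open>\<beta>1 = 0\<close> by (simp add: de)
      then have "4 * B ^ 3 - 1 = 1 \<or> 4 * B ^ 3 - 1 = -1"
        using W_odd[of "4 * B ^ 3 - 1" 8] 2 \<beta>1 \<open>\<beta>1 = 0\<close> gB by (simp add: power_mult_distrib)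
      then have "B ^ 3 = 0" by presburger
      then show False using g0 gB by simp
    next
      case 3
      then obtain Q k where Q: "q = 2 * Q" and k: "\<beta> = 2 * k + 1" by (elim evenE oddE)
      have g4: "g = 4 * (Q\<^sup>2 * B + k\<^sup>2 + k) + 1" unfolding g_def Q k by algebra
      then have "g = 1 \<or> g = -1" using ga_odd[of g 0] by simp
      with g4 have g: "g = 1" by presburger
      define t where "t = \<beta> - 2 * Q ^ 4"
      have de8: "8 * \<beta> * g - q ^ 4 = 2 ^ 3 * t" by (simp add: g Q t_def power_mult_distrib)
      have "odd t" using 3 by (simp add: t_def)
      then have t: "t = 1 \<or> t = -1" using de_odd de8 by blast
      then have "de \<noteq> 0" using de8 by (auto simp: de)
      moreover have "16 * g ^ 3 + q ^ 4 * (8 * \<beta> * g - q ^ 4) = 2 ^ 4 * (1 + 8 * (Q ^ 4 * t))"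
        unfolding de8 by (simp add: g Q power_mult_distrib)
      moreover have "odd (1 + 8 * (Q ^ 4 * t))" by simp
      ultimately have "1 + 8 * (Q ^ 4 * t) = 1 \<or> 1 + 8 * (Q ^ 4 * t) = -1"
        using W_odd by blast
      then have "Q ^ 4 * t = 0" by presburger
      then show False using t q Q by auto
    next
      case 4
      then obtain Q k where Q: "q = 4 * Q" and k: "\<beta> = 2 * k" by (elim dvdE)
      with 4 have "odd k" by auto
      then obtain l where l: "k = 2 * l + 1" by (elim oddE)
      define g' where "g' = 4 * Q\<^sup>2 * B + k\<^sup>2"
      have g4: "g = 2 ^ 2 * g'" unfolding g_def g'_def Q k by algebra
      have g'4: "g' = 4 * (Q\<^sup>2 * B + l\<^sup>2 + l) + 1" unfolding g'_def l by algebra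
      then have "g' = 1 \<or> g' = -1" using ga_odd[OF _ g4] by simp
      with g'4 have "g' = 1" by presburger
      with g4 have g: "g = 4" by simp
      define t where "t = k - 4 * Q ^ 4"
      have de8: "8 * \<beta> * g - q ^ 4 = 2 ^ 6 * t" by (simp add: g Q k t_def power_mult_distrib)
      have "odd t" using \<open>odd k\<close> by (simp add: t_def)
      then have t: "t = 1 \<or> t = -1" using de_odd de8 by blast
      then have "de \<noteq> 0" using de8 by (auto simp: de)
      moreover have "16 * g ^ 3 + q ^ 4 * (8 * \<beta> * g - q ^ 4) = 2 ^ 10 * (1 + 16 * (Q ^ 4 * t))"
        unfolding de8 by (simp add: g Q power_mult_distrib)
      moreover have "odd (1 + 16 * (Q ^ 4 * t))" by simp
      ultimately have "1 + 16 * (Q ^ 4 * t) = 1 \<or> 1 + 16 * (Q ^ 4 * t) = -1"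
        using W_odd by blast
      then have "Q ^ 4 * t = 0" by presburger
      then show False using t q Q by auto
    next
      case 5
      then obtain Q k where Q: "q = 4 * Q" and k: "\<beta> = 4 * k" by (elim dvdE)
      have "d = [:r, q, p, 0, 1:]" using d_expand by (simp add: c3 rqp)
      also have "\<dots> = [:B, 0, 1:]\<^sup>2 + 4 * [:k, Q:]"
        using Q k B \<beta>_def by (simp add: numeral_poly power2_eq_square algebra_simps)
      finally show False
        using not_pellian_if_square_mod_4[of "[:B, 0, 1:]" "[:k, Q:]"] pell by simp
    qed
  qed
qed

text \<open>For odd \<open>p\<close>, \<open>d = (x^2 + x + B)^2 + a * x + \<beta>\<close>. The
  parity argument leaves two polynomials, both with \<open>de = 0\<close>: one has the square factor
  \<open>x^2\<close>, the other is the target.\<close>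

lemma pellian_coeff_3_two:
  assumes c3: "coeff d 3 = 2" and pos: "al > 0" "ga \<noteq> 0" and pell: "pellian d"
    and sqf: "\<not> [:0, 1:]\<^sup>2 dvd d"
  shows "d = [:-2, 0, 1:] * [:-5, 2, 1:]"
proof -
  define r q p where "r = coeff d 0" "q = coeff d 1" "p = coeff d 2"
  note rqp = this
  define a where "a = q - p + 1"
  have h: "h = 1 / 2" by (simp add: h_def c3)
  have al: "al = of_int a" by (simp add: al_def h rqp a_def power_eq_if)
  have b: "b = of_int p / 2 - 3 / 4" by (simp add: b_def h rqp power2_eq_square)
  have be: "be = of_int r - (of_int p / 2 - 1 / 2)\<^sup>2 - of_int a / 2"
    by (simp add: be_def h b al rqp power2_eq_square)
  have a: "a > 0" using pos al by simp
  have du_al: "dyadic_unit al" and du_ga: "dyadic_unit ga"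
    and du_de: "de \<noteq> 0 \<Longrightarrow> dyadic_unit de"
    and du_W: "de \<noteq> 0 \<Longrightarrow> 16 * ga ^ 3 + al ^ 4 * de \<noteq> 0 \<Longrightarrow> dyadic_unit (16 * ga ^ 3 + al ^ 4 * de)"
    using pell pos al_dyadic_unit ga_dyadic_unit de_dyadic_unit by auto
  have a_odd: "k = 1 \<or> k = -1" if "odd k" "a = 2 ^ m * k" for k m
    using dyadic_unit_odd_part[OF du_al, of 0 m k] that by (simp add: al)
  show ?thesis
  proof (cases "odd p")
    case False
    then obtain P where P: "p = 2 * P" by (auto elim: evenE)
    \<comment> \<open>Again \<open>w = 4 * be\<close> is odd; the conditions on \<open>ga\<close>
      and \<open>de\<close> lead to \<open>4\<close> dividing \<open>3\<close>.\<close>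
    define w where "w = 4 * (r - P\<^sup>2 + P) - 1 - 2 * a"
    have "odd w" by (simp add: w_def)
    then obtain k where k: "w = 2 * k + 1" by (elim oddE)
    have be: "be = of_int w / 4" by (simp add: be w_def P power2_eq_square field_simps)
    define X where "X = 16 * a\<^sup>2 * P - 12 * a\<^sup>2 + w\<^sup>2"
    have ga16: "2 ^ 4 * ga = of_int (2 ^ 0 * X)"
      by (simp add: ga_def al b be P X_def power2_eq_square field_simps)
    have "odd X" using \<open>odd w\<close> by (simp add: X_def)
    then have X: "X = 1 \<or> X = -1" using dyadic_unit_odd_part[OF du_ga ga16] by simp
    have "X = 4 * (4 * a\<^sup>2 * P - 3 * a\<^sup>2 + k\<^sup>2 + k) + 1" unfolding X_def k by algebra
    with X have X1: "X = 1" by presburger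
    then have ga: "ga = 1 / 16" using ga16 by simp
    have de8: "2 ^ 3 * de = of_int (2 ^ 0 * (w - 8 * a ^ 4))"
      by (simp add: de_def ga be al)
    have "odd (w - 8 * a ^ 4)" using \<open>odd w\<close> by simp
    moreover have "de \<noteq> 0"
    proof
      assume "de = 0"
      then have "of_int (2 ^ 0 * (w - 8 * a ^ 4)) = (0::rat)" using de8 by (simp only: mult_zero_right)
      then have "w - 8 * a ^ 4 = 0" by (simp only: of_int_eq_0_iff power_0 mult_1)
      with \<open>odd (w - 8 * a ^ 4)\<close> show False by simp
    qed
    ultimately have "w - 8 * a ^ 4 = 1 \<or> w - 8 * a ^ 4 = -1"
      using dyadic_unit_odd_part[OF du_de de8] by blast
    then obtain s where s: "w = 8 * a ^ 4 + s" "s\<^sup>2 = 1" by (metis add.commute diff_add_cancel one_power2 power2_minus)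
    have "4 * a\<^sup>2 * (4 * P - 3 + 4 * (4 * a ^ 6 + s * a\<^sup>2)) = 0"
      using X1 s unfolding X_def by algebra
    then have "4 * P - 3 + 4 * (4 * a ^ 6 + s * a\<^sup>2) = 0" using a by simp
    then have "4 * (P + (4 * a ^ 6 + s * a\<^sup>2)) = 3" by (simp only: distrib_left)
    then have "4 dvd (3 :: int)" by (metis dvd_triv_left)
    then show ?thesis by simp
  next
    case True
    then obtain B where B: "p = 2 * B + 1" by (elim oddE)
    define \<beta> where "\<beta> = r - B\<^sup>2"
    define g where "g = a\<^sup>2 * B + \<beta>\<^sup>2 - a * \<beta>"
    have b: "b = of_int B - 1 / 4" by (simp add: b B field_simps)
    have be: "be = of_int \<beta> - of_int a / 2" by (simp add: be B \<beta>_def power2_eq_square field_simps)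
    have ga: "ga = of_int g" by (simp add: ga_def al b be g_def power2_eq_square field_simps)
    have de: "de = of_int (8 * \<beta> * g - 4 * a * g - a ^ 4)" by (simp add: de_def al be ga field_simps)
    have d: "d = [:B, 1, 1:]\<^sup>2 + [:\<beta>, a:]"
    proof -
      have "d = [:r, q, p, 2, 1:]" using d_expand by (simp add: c3 rqp)
      also have "\<dots> = [:B, 1, 1:]\<^sup>2 + [:\<beta>, a:]"
        using B by (simp add: \<beta>_def a_def power2_eq_square)
      finally show ?thesis .
    qed
    have W: "16 * ga ^ 3 + al ^ 4 * de = of_int (16 * g ^ 3 + a ^ 4 * (8 * \<beta> * g - 4 * a * g - a ^ 4))"
      by (simp add: al ga de)
    have W_odd: "k = 1 \<or> k = -1"
      if "de \<noteq> 0" "odd k" "16 * g ^ 3 + a ^ 4 * (8 * \<beta> * g - 4 * a * g - a ^ 4) = 2 ^ m * k" for k m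
    proof (rule dyadic_unit_odd_part)
      show "dyadic_unit (16 * ga ^ 3 + al ^ 4 * de)" using that by (intro du_W) (auto simp: W)
      show "2 ^ 0 * (16 * ga ^ 3 + al ^ 4 * de) = of_int (2 ^ m * k)" unfolding W that(3) by simp
    qed fact
    have de_odd: "k = 1 \<or> k = -1" if "odd k" "8 * \<beta> * g - 4 * a * g - a ^ 4 = 2 ^ m * k" for k m
    proof (rule dyadic_unit_odd_part)
      show "dyadic_unit de" using that by (intro du_de) (auto simp: de)
      show "2 ^ 0 * de = of_int (2 ^ m * k)" unfolding de that(2) by simp
    qed fact
    have ga_odd: "k = 1 \<or> k = -1" if "odd k" "g = 2 ^ m * k" for k m
      using dyadic_unit_odd_part[OF du_ga, of 0 m k] that by (simp add: ga)
    have g0: "g \<noteq> 0" using pos ga by simp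
    have "a = 1 \<or> a = 2 \<or> 4 dvd a"
    proof (cases "odd a")
      case True
      then show ?thesis using a_odd[of a 0] a by simp
    next
      case False
      then obtain k where k: "a = 2 * k" by (auto elim: evenE)
      then show ?thesis using a_odd[of k 1] a by (cases "odd k") auto
    qed
    then consider "a = 1" | "a = 2" "even \<beta>" | "a = 2" "odd \<beta>" | "4 dvd a" "odd \<beta>"
      | "4 dvd a" "even \<beta>" "\<not> 4 dvd \<beta>" | "4 dvd a" "4 dvd \<beta>"
      by blast
    then show ?thesis
    proof cases
      case 1
      have de1: "8 * \<beta> * g - 4 * a * g - a ^ 4 = 2 ^ 0 * (4 * (g * (2 * \<beta> - 1)) - 1)" using 1 by (simp add: algebra_simps)
      have "4 * (g * (2 * \<beta> - 1)) - 1 = 1 \<or> 4 * (g * (2 * \<beta> - 1)) - 1 = -1"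
        by (rule de_odd[OF _ de1]) simp
      then have "g * (2 * \<beta> - 1) = 0" by presburger
      then have "2 * \<beta> - 1 = 0" using g0 by simp
      then have False by presburger
      then show ?thesis ..
    next
      case 2
      then obtain \<beta>1 where \<beta>1: "\<beta> = 2 * \<beta>1" by (elim evenE)
      define g' where "g' = B + \<beta>1\<^sup>2 - \<beta>1"
      have g: "g = 4 * g'" using 2 \<beta>1 by (simp add: g_def g'_def power2_eq_square)
      have de16: "8 * \<beta> * g - 4 * a * g - a ^ 4 = 2 ^ 4 * (2 * (g' * (2 * \<beta>1 - 1)) - 1)"
        using 2 by (simp add: \<beta>1 g algebra_simps)
      have "2 * (g' * (2 * \<beta>1 - 1)) - 1 = 1 \<or> 2 * (g' * (2 * \<beta>1 - 1)) - 1 = -1"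
        by (rule de_odd[OF _ de16]) simp
      moreover have "2 * \<beta>1 - 1 \<noteq> 0" by presburger
      then have "g' * (2 * \<beta>1 - 1) \<noteq> 0" using g0 g by simp
      ultimately have g'1: "g' * (2 * \<beta>1 - 1) = 1" by presburger
      then have g': "g' = 1 \<or> g' = -1" using zmult_eq_1_iff by blast
      have "de \<noteq> 0" unfolding de de16 g'1 by simp
      moreover have "16 * g ^ 3 + a ^ 4 * (8 * \<beta> * g - 4 * a * g - a ^ 4) = 2 ^ 8 * (4 * g' ^ 3 + 1)"
        unfolding de16 g'1 using 2 by (simp add: g power_mult_distrib)
      moreover have "odd (4 * g' ^ 3 + 1)" by simp
      ultimately have "4 * g' ^ 3 + 1 = 1 \<or> 4 * g' ^ 3 + 1 = -1" using W_odd by blast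
      then show ?thesis using g' by auto
    next
      case 3
      then obtain l where l: "\<beta> = 2 * l + 1" by (elim oddE)
      have g4: "g = 4 * (B + l\<^sup>2) - 1" using 3 unfolding g_def l by (simp add: power2_eq_square algebra_simps)
      then have "g = 1 \<or> g = -1" using ga_odd[of g 0] by simp
      with g4 have g: "g = -1" by presburger
      have de8: "8 * \<beta> * g - 4 * a * g - a ^ 4 = 2 ^ 4 * (- (l + 1))" using 3 by (simp add: g l)
      have "l = -1"
      proof (cases "de = 0")
        case True
        then have "2 ^ 4 * (- (l + 1)) = 0" unfolding de de8 by (simp only: of_int_eq_0_iff)
        then show ?thesis by simp
      next
        case False
        have "16 * g ^ 3 + a ^ 4 * (8 * \<beta> * g - 4 * a * g - a ^ 4) = 2 ^ 4 * (- (1 + 16 * (l + 1)))"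
          unfolding de8 using 3 by (simp add: g)
        moreover have "odd (- (1 + 16 * (l + 1)))" by simp
        ultimately have "- (1 + 16 * (l + 1)) = 1 \<or> - (1 + 16 * (l + 1)) = -1"
          using W_odd False by blast
        then show ?thesis by presburger
      qed
      moreover from this have "B = -1" using g4 g by simp
      \<comment> \<open>This polynomial satisfies the conditions on \<open>al\<close> and
        \<open>ga\<close> and has \<open>de = 0\<close>; its square factor excludes it.\<close>
      ultimately have "d = [:0, 1:]\<^sup>2 * [:-1, 2, 1:]"
        using 3 by (simp add: d l power2_eq_square)
      then show ?thesis using sqf by (metis dvd_triv_left)
    next
      case 4
      then obtain Q k where Q: "a = 4 * Q" and k: "\<beta> = 2 * k + 1" by (elim dvdE oddE)
      have g4: "g = 4 * (4 * Q\<^sup>2 * B + k\<^sup>2 + k - Q * \<beta>) + 1" unfolding g_def Q k by algebra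
      then have "g = 1 \<or> g = -1" using ga_odd[of g 0] by simp
      with g4 have g: "g = 1" by presburger
      define t where "t = \<beta> - 2 * Q - 32 * Q ^ 4"
      have de8: "8 * \<beta> * g - 4 * a * g - a ^ 4 = 2 ^ 3 * t" by (simp add: g Q t_def power_mult_distrib)
      have "odd t" using 4 by (simp add: t_def)
      then have t: "t = 1 \<or> t = -1" using de_odd de8 by blast
      then have "de \<noteq> 0" unfolding de de8 by auto
      moreover have "16 * g ^ 3 + a ^ 4 * (8 * \<beta> * g - 4 * a * g - a ^ 4) = 2 ^ 4 * (1 + 128 * (Q ^ 4 * t))"
        unfolding de8 by (simp add: g Q power_mult_distrib)
      moreover have "odd (1 + 128 * (Q ^ 4 * t))" by simp
      ultimately have "1 + 128 * (Q ^ 4 * t) = 1 \<or> 1 + 128 * (Q ^ 4 * t) = -1"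
        using W_odd by blast
      then have "Q ^ 4 * t = 0" by presburger
      then show ?thesis using t a Q by auto
    next
      case 5
      then obtain Q k where Q: "a = 4 * Q" and k: "\<beta> = 2 * k" by (elim dvdE)
      with 5 have "odd k" by auto
      define g' where "g' = 4 * Q\<^sup>2 * B + k\<^sup>2 - 2 * Q * k"
      have g4: "g = 2 ^ 2 * g'" unfolding g_def g'_def Q k by algebra
      have "odd g'" using \<open>odd k\<close> by (simp add: g'_def)
      then have g': "g' = 1 \<or> g' = -1" using ga_odd g4 by blast
      define t where "t = g' * (k - Q) - 4 * Q ^ 4"
      have de8: "8 * \<beta> * g - 4 * a * g - a ^ 4 = 2 ^ 6 * t"
        by (simp add: g4 Q k t_def power_mult_distrib algebra_simps)
      have W10: "16 * g ^ 3 + a ^ 4 * (8 * \<beta> * g - 4 * a * g - a ^ 4) = 2 ^ 10 * (g' ^ 3 + 16 * (Q ^ 4 * t))"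
        unfolding de8 by (simp add: g4 Q power_mult_distrib)
      \<comment> \<open>Otherwise \<open>g' ^ 3\<close> and \<open>g' ^ 3 + 16 * (Q ^ 4 * t)\<close>
        would both be \<open>1\<close> or \<open>-1\<close> while differing by a nonzero multiple of
        \<open>16\<close>.\<close>
      have "t = 0"
      proof (rule ccontr)
        assume "t \<noteq> 0"
        then have "de \<noteq> 0" unfolding de de8 by simp
        moreover have "odd (g' ^ 3 + 16 * (Q ^ 4 * t))" using \<open>odd g'\<close> by simp
        ultimately have "g' ^ 3 + 16 * (Q ^ 4 * t) = 1 \<or> g' ^ 3 + 16 * (Q ^ 4 * t) = -1"
          using W_odd W10 by blast
        moreover have "g' ^ 3 = 1 \<or> g' ^ 3 = -1" using g' by auto
        ultimately have "Q ^ 4 * t = 0" by presburger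
        then show False using \<open>t \<noteq> 0\<close> a Q by auto
      qed
      \<comment> \<open>So \<open>k\<close> and \<open>Q\<close> have the same parity. As
        \<open>k\<close> is odd and \<open>Q\<close> is a power of \<open>2\<close>,
        \<open>Q = 1\<close>, and the definition of \<open>g'\<close> then fixes \<open>g'\<close>
        and \<open>B\<close>.\<close>
      then have "g' * (k - Q) = 4 * Q ^ 4" by (simp add: t_def)
      then have k': "k = Q + 4 * g' * Q ^ 4" using g' by auto
      then have "odd Q" using \<open>odd k\<close> by auto
      then have Q1: "Q = 1" using a_odd[of Q 2] a Q by auto
      have "g' = 4 * B + (4 * g')\<^sup>2 - 1" unfolding g'_def[symmetric] using k' Q1
        by (subst g'_def) (simp add: power2_eq_square algebra_simps)
      moreover have "(4 * g')\<^sup>2 = 16" using g' by auto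
      ultimately have "g' = 4 * B + 15" by simp
      then have gB: "g' = -1" "B = -4" using g' by presburger+
      show ?thesis
        by (simp add: d k k' Q Q1 gB power2_eq_square)
    next
      case 6
      then obtain Q k where Q: "a = 4 * Q" and k: "\<beta> = 4 * k" by (elim dvdE)
      have "d = [:B, 1, 1:]\<^sup>2 + 4 * [:k, Q:]" by (simp add: d Q k numeral_poly)
      then show ?thesis
        using not_pellian_if_square_mod_4[of "[:B, 1, 1:]" "[:k, Q:]"] pell by simp
    qed
  qed
qed

end

section \<open>Short periods\<close>

lemma map_poly_fls_const_mult:
  "map_poly fls_const (p * q :: 'a::field poly) = map_poly fls_const p * map_poly fls_const q"
proof (rule poly_eqI)
  fix n
  have sum: "fls_const (sum h A) = (\<Sum>i\<in>A. fls_const (h i))" for h :: "nat \<Rightarrow> 'a" and A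
    by (induction A rule: infinite_finite_induct) (auto simp: fls_plus_const [symmetric])
  show "coeff (map_poly fls_const (p * q)) n = coeff (map_poly fls_const p * map_poly fls_const q) n"
    by (simp add: coeff_map_poly coeff_mult sum)
qed

lemma poly_to_fls_mult: "poly_to_fls (p * q) = poly_to_fls p * poly_to_fls q"
  by (simp add: poly_to_fls_def map_poly_fls_const_mult)

lemma poly_to_fls_add: "poly_to_fls (p + q) = poly_to_fls p + poly_to_fls q"
  by (intro fls_eqI) (simp add: nth_poly_to_fls)

lemma principal_part_eqI:
  assumes "\<And>k. k \<le> 0 \<Longrightarrow> (x - poly_to_fls p) $$ k = 0"
  shows "principal_part x = p"
proof (rule poly_eqI)
  fix n
  show "coeff (principal_part x) n = coeff p n"
    using assms[of "- int n"] by (simp add: coeff_principal_part nth_poly_to_fls)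
qed

text \<open>If \<open>D = A\<^sup>2 + R\<close> with \<open>R\<close> dividing \<open>2 A\<close>, then \<open>\<surd>D = [A; 2A/R, 2A, 2A/R, 2A, \<dots>]\<close>.\<close>

lemma cf_period_le_2:
  fixes s :: "'a::field_char_0 fls"
  assumes s: "s\<^sup>2 = poly_to_fls (A\<^sup>2 + R)" "fls_subdegree s = -2" "s $$ (-2) = 1"
    and A: "degree A = 2" "lead_coeff A = 1" and R: "degree R \<le> 1" "R dvd 2 * A"
    and n: "n > 2"
  shows "\<not> cf_periodic s n"
proof
  assume per: "cf_periodic s n"
  define a where "a = poly_to_fls A"
  define y where "y = s - a"
  have ya: "y * (s + a) = poly_to_fls R"
    using s(1) by (simp add: y_def a_def poly_to_fls_add poly_to_fls_mult power2_eq_square algebra_simps)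
  have sa: "fls_subdegree (s + a) = -2"
  proof (rule fls_subdegree_eqI)
    have "coeff A 2 = 1" using A by simp
    then show "(s + a) $$ (-2) \<noteq> 0" using s by (simp add: a_def nth_poly_to_fls)
    show "(s + a) $$ k = 0" if "k < -2" for k
      using that s(2) A(1) by (simp add: a_def nth_poly_to_fls coeff_eq_0)
  qed
  then have sa0: "s + a \<noteq> 0" by auto
  \<comment> \<open>From \<open>y * (s + a) = R\<close> the degree of a nonzero \<open>y\<close> is
    at most \<open>1 - 2\<close>, so \<open>y\<close> is the fractional part of
    \<open>s\<close>.\<close>
  have y: "y $$ k = 0" if "k \<le> 0" for k
  proof (cases "y = 0")
    case False
    then have nz: "poly_to_fls R \<noteq> 0" using ya sa0 by (metis mult_eq_0_iff)
    have "fls_subdegree (poly_to_fls R) \<ge> -1"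
      by (rule fls_subdegree_geI[OF nz]) (use R in \<open>auto simp: nth_poly_to_fls coeff_eq_0\<close>)
    moreover have "fls_subdegree (poly_to_fls R) = fls_subdegree y + fls_subdegree (s + a)"
      unfolding ya[symmetric] using False sa0 by (rule fls_subdegree_mult)
    ultimately show ?thesis using sa that by simp
  qed simp
  have c0: "cf_complete s 0 - poly_to_fls (principal_part (cf_complete s 0)) = y"
  proof -
    have "principal_part s = A" by (rule principal_part_eqI) (use y in \<open>simp add: y_def a_def\<close>)
    then show ?thesis by (simp add: y_def a_def)
  qed
  have y0: "y \<noteq> 0"
    using per c0 unfolding cf_periodic_def cf_infinite_def by (metis right_minus_eq)
  obtain q where q: "2 * A = R * q" using R(2) by (elim dvdE)
  have rq: "2 * a = poly_to_fls R * poly_to_fls q"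
    using arg_cong[OF q, of poly_to_fls] unfolding mult_2 poly_to_fls_add poly_to_fls_mult a_def .
  \<comment> \<open>\<open>1 / y = (s + a) / R = (2 * a + y) / R\<close>, and
    \<open>y / R = 1 / (s + a)\<close>.\<close>
  have inv_y: "inverse y = poly_to_fls q + inverse (s + a)"
  proof -
    have "(poly_to_fls q + inverse (s + a)) * (y * (s + a)) = poly_to_fls R * poly_to_fls q + y"
    proof -
      have "inverse (s + a) * (s + a) = 1" using sa0 by simp
      then show ?thesis unfolding ya[symmetric] by algebra
    qed
    also have "\<dots> = s + a" unfolding rq[symmetric] y_def by simp
    finally have "(poly_to_fls q + inverse (s + a)) * y = 1" using sa0 by simp
    then show ?thesis using y0 by (simp add: field_simps)
  qed
  have inv_sa: "fls_subdegree (inverse (s + a)) = 2" using sa by simp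
  have step1: "cf_complete s (Suc (Suc k)) = s + a" if "cf_complete s (Suc k) = inverse y" for k
  proof -
    have "principal_part (inverse y) = q"
      by (rule principal_part_eqI) (use inv_sa in \<open>simp add: inv_y\<close>)
    then show ?thesis using that by (simp add: inv_y)
  qed
  have step2: "cf_complete s (Suc k) = inverse y" if "cf_complete s k = s + a" for k
  proof -
    have eq: "s + a - poly_to_fls (2 * A) = y"
      unfolding mult_2 poly_to_fls_add by (simp add: y_def a_def)
    have "principal_part (s + a) = 2 * A"
      by (rule principal_part_eqI) (simp only: eq y)
    then show ?thesis by (simp only: cf_complete.simps that eq)
  qed
  have odd: "cf_complete s (Suc (2 * k)) = inverse y" for k
  proof (induction k)
    case 0
    then show ?case using c0 by simp
  next
    case (Suc k)
    then show ?case using step2[OF step1[OF Suc]] by (simp only: mult_Suc_right add_2_eq_Suc)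
  qed
  \<comment> \<open>Index \<open>0\<close> is left out because the initial quotient is
    \<open>A\<close> rather than \<open>2 * A\<close>.\<close>
  have "cf_complete s (k + 2) = cf_complete s k" if "k \<ge> 1" for k
  proof (cases "odd k")
    case True
    then obtain l where "k = Suc (2 * l)" by (auto elim: oddE)
    then show ?thesis using odd[of l] odd[of "Suc l"] by simp
  next
    case False
    then obtain j where "k = 2 * j" by (auto elim: evenE)
    moreover from this that obtain l where "j = Suc l" by (cases j) auto
    ultimately have "k = Suc (Suc (2 * l))" by simp
    then show ?thesis using step1[OF odd[of l]] step1[OF odd[of "Suc l"]] by simp
  qed
  then have "eventually_repeats (cf_quotient s) 2"
    by (auto simp: eventually_repeats_def cf_quotient_def intro!: exI[of _ 1])
  then show False using per n by (auto simp: cf_periodic_def)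
qed

context monic_quartic begin

text \<open>If \<open>al\<close> or \<open>ga\<close> vanishes, the remainder \<open>R\<close>
  divides \<open>2 * A\<close> and the period is at most \<open>2\<close>. For \<open>R = 0\<close>
  the root is a polynomial and its expansion terminates.\<close>

lemma period_params_nonzero:
  assumes "cf_periodic (sqrt_quartic d) n" "n \<ge> 4"
  shows "al \<noteq> 0 \<and> ga \<noteq> 0"
proof (rule ccontr)
  assume neg: "\<not> (al \<noteq> 0 \<and> ga \<noteq> 0)"
  define Z where "Z = [:h, 1:]"
  define A where "A = Z\<^sup>2 + [:b:]"
  define R where "R = [:al:] * Z + [:be:]"
  have D: "map_poly of_int d = A\<^sup>2 + R"
    by (rule poly_eq_poly_eq_iff[THEN iffD1], rule ext)
      (simp add: poly_d A_def R_def Z_def add.commute distrib_left mult.commute)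
  have s: "(sqrt_quartic d)\<^sup>2 = poly_to_fls (map_poly of_int d) \<and> fls_subdegree (sqrt_quartic d) = -2
      \<and> sqrt_quartic d $$ (-2) = 1"
    unfolding sqrt_quartic_def by (rule theI'[OF sqrt_quartic_ex1[OF lead_coeff_d degree_d]])
  have A: "degree A = 2" "lead_coeff A = 1"
    by (simp_all add: A_def Z_def power2_eq_square)
  have degR: "degree R \<le> 1" by (simp add: R_def Z_def)
  have "R dvd 2 * A"
  proof (cases "al = 0")
    case False
    then have "al\<^sup>2 * b + be\<^sup>2 = 0" using neg by (simp add: ga_def)
    then have be: "[:be:]\<^sup>2 = - ([:al:]\<^sup>2 * [:b:])"
      by (simp add: power2_eq_square eq_neg_iff_add_eq_0 mult_ac add.commute)
    have "R * ([:al:] * Z - [:be:]) = [:al:]\<^sup>2 * A"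
      unfolding R_def A_def using be by algebra
    moreover have "[:al:]\<^sup>2 * A = smult (al\<^sup>2) A" by (simp add: power2_eq_square)
    ultimately have "R dvd smult (al\<^sup>2) A" by (metis dvd_triv_left)
    then have "R dvd A" using False by (simp add: dvd_smult_iff)
    then show ?thesis by (rule dvd_mult)
  next
    case True
    show ?thesis
    proof (cases "be = 0")
      case False
      then have "is_unit R" using True by (simp add: R_def is_unit_const_poly_iff dvd_field_iff)
      then show ?thesis by (rule unit_imp_dvd)
    next
      case b0: True
      then have "R = 0" using True by (simp add: R_def)
      then have "(sqrt_quartic d)\<^sup>2 = (poly_to_fls A)\<^sup>2"
        using s by (simp add: D poly_to_fls_mult power2_eq_square)
      then have "sqrt_quartic d = poly_to_fls A \<or> sqrt_quartic d = - poly_to_fls A"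
        by (simp add: power2_eq_iff)
      moreover have "coeff A 2 = 1" using A by simp
      then have "poly_to_fls A $$ (-2) = 1" by (simp add: nth_poly_to_fls)
      ultimately have eq: "sqrt_quartic d = poly_to_fls A" using s by auto
      then have "principal_part (sqrt_quartic d) = A" by (intro principal_part_eqI) simp
      then have "cf_complete (sqrt_quartic d) 0
        = poly_to_fls (principal_part (cf_complete (sqrt_quartic d) 0))" using eq by simp
      then have False using assms(1) unfolding cf_periodic_def cf_infinite_def by blast
      then show ?thesis ..
    qed
  qed
  then show False
    using cf_period_le_2[of "sqrt_quartic d" A R n] s A degR assms by (simp add: D)
qed

end

section \<open>Change of variables\<close>

lemma pellian_pcompose:
  fixes d :: "int poly"
  assumes "pellian d" "\<epsilon> \<in> {1, -1}"
  shows "pellian (pcompose d [:c, \<epsilon>:])"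
proof -
  define L where "L = [:c, \<epsilon>:]"
  define L' where "L' = [:- (\<epsilon> * c), \<epsilon>:]"
  have LL': "pcompose L L' = [:0, 1:]" using assms(2) by (auto simp: L_def L'_def pcompose_pCons)
  have degL: "degree L > 0" using assms(2) by (auto simp: L_def)
  have "\<not> is_square (pcompose d L)"
  proof
    assume "is_square (pcompose d L)"
    then obtain g where "pcompose d L = g\<^sup>2" by (auto simp: is_nth_power_def)
    then have "pcompose (pcompose d L) L' = (pcompose g L')\<^sup>2"
      by (simp add: power2_eq_square pcompose_mult)
    then have "d = (pcompose g L')\<^sup>2" by (simp add: pcompose_assoc[symmetric] LL')
    then show False using assms(1) by (auto simp: pellian_def is_nth_power_def)
  qed
  moreover obtain f g where fg: "g \<noteq> 0" "f\<^sup>2 - d * g\<^sup>2 = 1" using assms(1) by (auto simp: pellian_def)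
  have "(pcompose f L)\<^sup>2 - pcompose d L * (pcompose g L)\<^sup>2 = pcompose (f\<^sup>2 - d * g\<^sup>2) L"
    by (simp add: power2_eq_square pcompose_mult pcompose_diff)
  then have "(pcompose f L)\<^sup>2 - pcompose d L * (pcompose g L)\<^sup>2 = 1"
    by (simp add: fg(2) pcompose_1)
  moreover have "pcompose g L \<noteq> 0" using fg(1) degL by (simp add: pcompose_eq_0_iff)
  ultimately show ?thesis unfolding L_def[symmetric] pellian_def by blast
qed

text \<open>In the coordinate \<open>z\<close> the substitution is
  \<open>z -> \<epsilon> * z\<close>, which affects only the sign of \<open>al\<close>.\<close>

lemma monic_quartic_pcompose:
  assumes "monic_quartic d" "\<epsilon> \<in> {1, -1}"
  shows "monic_quartic (pcompose d [:c, \<epsilon>:])"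
    and "coeff (pcompose d [:c, \<epsilon>:]) 3 = \<epsilon> * (coeff d 3 + 4 * c)"
    and "monic_quartic.al (pcompose d [:c, \<epsilon>:]) = of_int \<epsilon> * monic_quartic.al d"
    and "monic_quartic.ga (pcompose d [:c, \<epsilon>:]) = monic_quartic.ga d"
proof -
  interpret d: monic_quartic d by fact
  define e where "e = pcompose d [:c, \<epsilon>:]"
  obtain r q p t where d: "d = [:r, q, p, t, 1:]" using d.d_expand by blast
  have \<epsilon>: "\<epsilon> * \<epsilon> = 1" "\<epsilon> * (\<epsilon> * x) = x" for x using assms(2) by auto
  have e: "e = [:r + q * c + p * c\<^sup>2 + t * c ^ 3 + c ^ 4, \<epsilon> * (q + 2 * p * c + 3 * t * c\<^sup>2 + 4 * c ^ 3),
     p + 3 * t * c + 6 * c\<^sup>2, \<epsilon> * (t + 4 * c), 1:]"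
    by (simp add: e_def d pcompose_pCons \<epsilon> algebra_simps power_eq_if)
  show "monic_quartic (pcompose d [:c, \<epsilon>:])"
    unfolding e_def[symmetric] by unfold_locales (simp_all add: e)
  then interpret e: monic_quartic e unfolding e_def .
  show "coeff (pcompose d [:c, \<epsilon>:]) 3 = \<epsilon> * (coeff d 3 + 4 * c)"
    unfolding e_def[symmetric] by (simp add: e d eval_nat_numeral)
  have coeffs: "coeff e 3 = \<epsilon> * (t + 4 * c)" "coeff e 2 = p + 3 * t * c + 6 * c\<^sup>2"
    "coeff e 1 = \<epsilon> * (q + 2 * p * c + 3 * t * c\<^sup>2 + 4 * c ^ 3)"
    "coeff e 0 = r + q * c + p * c\<^sup>2 + t * c ^ 3 + c ^ 4"
    by (simp_all add: e eval_nat_numeral)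
  have coeffd: "coeff d 3 = t" "coeff d 2 = p" "coeff d 1 = q" "coeff d 0 = r"
    by (simp_all add: d eval_nat_numeral)
  have eh: "e.h = of_int \<epsilon> * (d.h + of_int c)"
    by (simp add: e.h_def d.h_def coeffs coeffd field_simps)
  have t: "of_int t = 4 * d.h" by (simp add: d.h_def coeffd)
  have e2: "(of_int \<epsilon>)\<^sup>2 = (1 :: rat)" using assms(2) by auto
  have p: "of_int p = 2 * d.b + 6 * d.h\<^sup>2" by (simp add: d.b_def coeffd)
  have q: "of_int q = d.al + 2 * of_int p * d.h - 8 * d.h ^ 3" unfolding d.al_def coeffd by simp
  have eh2: "e.h\<^sup>2 = (d.h + of_int c)\<^sup>2" using e2 by (simp add: eh power_mult_distrib)
  have eb: "e.b = d.b"
    unfolding e.b_def coeffs eh2 by (simp add: t p power2_eq_square field_simps)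
  have eh3: "e.h ^ 3 = of_int \<epsilon> * (d.h + of_int c) ^ 3"
    using e2 unfolding eh by algebra
  show al: "e.al = of_int \<epsilon> * d.al"
    unfolding e.al_def coeffs eh3 unfolding eh by (simp add: t q p) algebra
  have alh: "e.al * e.h = d.al * (d.h + of_int c)" using e2 unfolding al eh by algebra
  have "e.be = d.be"
    unfolding e.be_def d.be_def eh2 eb alh coeffs coeffd by (simp add: t q p) algebra
  then show "e.ga = d.ga" using e2 by (simp add: e.ga_def d.ga_def al eb power_mult_distrib)
qed

text \<open>
  The solution is the square of \<open>((x + 3) \<surd>(x\<^sup>2 - 2) + (x + 2) \<surd>(x\<^sup>2 + 2 x - 5)) / \<surd>2\<close>, by
  \<open>(x\<^sup>2 - 2) (x + 3)\<^sup>2 - (x\<^sup>2 + 2 x - 5) (x + 2)\<^sup>2 = 2\<close>.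
\<close>

lemma pellian_target: "pellian ([:-2, 0, 1:] * [:-5, 2, 1:] :: int poly)" (is "pellian ?t")
proof -
  have "\<not> is_square ?t"
  proof
    assume "is_square ?t"
    then obtain g where "?t = g\<^sup>2" by (auto simp: is_nth_power_def)
    \<comment> \<open>The constant term \<open>10\<close> is not a square.\<close>
    then have "coeff ?t 0 = (coeff g 0)\<^sup>2" by (simp add: power2_eq_square coeff_mult)
    then have sq: "(coeff g 0)\<^sup>2 = 10" by simp
    have "\<bar>coeff g 0\<bar> < 4" by (rule power2_less_imp_less) (simp_all add: sq)
    then have "coeff g 0 \<in> {-3..3}" by auto
    moreover have "{-3..3} = {-3, -2, -1, 0, 1, 2, 3 :: int}" by auto
    ultimately show False using sq by auto
  qed
  moreover have "[:-19, -12, 7, 6, 1:]\<^sup>2 - ?t * [:6, 5, 1:]\<^sup>2 = 1"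
    by (simp add: power2_eq_square one_pCons)
  ultimately show ?thesis unfolding pellian_def by (metis pCons_eq_0_iff zero_neq_one)
qed

theorem theorem1p1:
  fixes d :: "int poly"
  assumes "lead_coeff d = 1" and "degree d = 4" and "squarefree d"
    and "\<exists>n\<ge>4. cf_periodic (sqrt_quartic d) n"
  shows "pellian d \<longleftrightarrow>
    (\<exists>\<epsilon>\<in>{1, -1}. \<exists>c::int.
       pcompose d [:c, \<epsilon>:] = [:-2, 0, 1:] * [:-5, 2, 1:])"
proof
  interpret d: monic_quartic d using assms(1,2) by unfold_locales
  have nz: "d.al \<noteq> 0" "d.ga \<noteq> 0" using d.period_params_nonzero assms(4) by auto
  assume pell: "pellian d"
  \<comment> \<open>The sign makes \<open>al\<close> positive, and the shift \<open>c\<close> brings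
    the cubic coefficient into \<open>{0, 1, 2, 3}\<close>.\<close>
  define \<epsilon> :: int where "\<epsilon> = (if d.al > 0 then 1 else -1)"
  have \<epsilon>: "\<epsilon> \<in> {1, -1}" by (simp add: \<epsilon>_def)
  define c where "c = - \<epsilon> * ((\<epsilon> * coeff d 3) div 4)"
  define e where "e = pcompose d [:c, \<epsilon>:]"
  interpret e: monic_quartic e
    unfolding e_def by (rule monic_quartic_pcompose[OF d.monic_quartic_axioms \<epsilon>])
  have e: "pellian e" "e.al > 0" "e.ga \<noteq> 0"
    using pellian_pcompose[OF pell \<epsilon>] monic_quartic_pcompose(3,4)[OF d.monic_quartic_axioms \<epsilon>] nz
    unfolding e_def by (auto simp: \<epsilon>_def split: if_splits)
  have "coeff e 3 = (\<epsilon> * coeff d 3) mod 4"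
    unfolding e_def monic_quartic_pcompose(2)[OF d.monic_quartic_axioms \<epsilon>]
    by (auto simp: c_def \<epsilon>_def minus_div_mult_eq_mod[symmetric])
  then have "coeff e 3 \<in> {0, 1, 2, 3}" by auto
  then have c3: "coeff e 3 = 2"
    using e.not_pellian_if_coeff_3_odd e.not_pellian_if_coeff_3_zero e by auto
  \<comment> \<open>A square factor is carried back to \<open>d\<close> by the inverse substitution
    \<open>L'\<close>.\<close>
  have "\<not> [:0, 1:]\<^sup>2 dvd e"
  proof
    assume "[:0, 1:]\<^sup>2 dvd e"
    define L' where "L' = [:- (\<epsilon> * c), \<epsilon>:]"
    obtain g where "e = [:0, 1:]\<^sup>2 * g" using \<open>[:0, 1:]\<^sup>2 dvd e\<close> by (elim dvdE)
    then have "pcompose e L' = (pcompose [:0, 1:] L')\<^sup>2 * pcompose g L'"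
      by (simp only: power2_eq_square pcompose_mult)
    moreover have "pcompose [:0, 1:] L' = L'" by (simp add: pcompose_pCons)
    moreover have "pcompose [:c, \<epsilon>:] L' = [:0, 1:]"
      using \<epsilon> by (auto simp: L'_def pcompose_pCons)
    then have "pcompose e L' = d" by (simp add: e_def pcompose_assoc[symmetric])
    ultimately have "L'\<^sup>2 dvd d" by simp
    then have "is_unit L'" using assms(3) by (simp add: squarefree_def)
    then show False using \<epsilon> by (auto simp: L'_def is_unit_poly_iff)
  qed
  then have "e = [:-2, 0, 1:] * [:-5, 2, 1:]" by (rule e.pellian_coeff_3_two[OF c3 e(2,3,1)])
  then show "\<exists>\<epsilon>\<in>{1, -1}. \<exists>c::int. pcompose d [:c, \<epsilon>:] = [:-2, 0, 1:] * [:-5, 2, 1:]"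
    using \<epsilon> unfolding e_def by blast
next
  assume "\<exists>\<epsilon>\<in>{1, -1}. \<exists>c::int. pcompose d [:c, \<epsilon>:] = [:-2, 0, 1:] * [:-5, 2, 1:]"
  then obtain \<epsilon> c :: int where \<epsilon>: "\<epsilon> \<in> {1, -1}"
    and c: "pcompose d [:c, \<epsilon>:] = [:-2, 0, 1:] * [:-5, 2, 1:]" by blast
  have "pcompose [:c, \<epsilon>:] [:- (\<epsilon> * c), \<epsilon>:] = [:0, 1:]"
    using \<epsilon> by (auto simp: pcompose_pCons)
  then have "pcompose (pcompose d [:c, \<epsilon>:]) [:- (\<epsilon> * c), \<epsilon>:] = d"
    by (simp add: pcompose_assoc[symmetric])
  then show "pellian d" using pellian_pcompose[OF pellian_target \<epsilon>, of "- (\<epsilon> * c)"] by (simp only: c)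
qed

end
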